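(* Let $\alpha\ge0$, $\mu>0$, $\beta\in(0,1]$, and let $g:\mathbb R\times\mathbb R\to\mathbb R$ be a kernel with $g(\cdot,x)\in L_2(\mathbb R)$ for all $x$. Consider the Gaussian random fields $$U_0^{g}(t,x)=\sqrt{C_1}\int_{\mathbb R}\widehat g(\lambda,x)E_\beta(-\mu t^\beta|\lambda|^\alpha)W(d\lambda),\qquad \tilde U_0^{g}(t,x)=\sqrt{C_2}\int_{\mathbb R}\widehat g(\lambda,x)E_\beta(-\mu t^\beta|\lambda|^\alpha)|\lambda|^{\frac{\kappa_0-1}2}W(d\lambda),$$ $t>0$, $x\in\mathbb R$, with constants $C_1=C(\bar\kappa,\bar w,\bar A)$, $C_2=C(\kappa_0,A_0)$ as in the context. (i) Assume that $g$ has finite Sobolev norm of order $-\alpha$ with respect to its first variable and that there exist $\theta\in(0,1]$ and $C>0$ with $\|g(z,x)-g(z,y)\|_{H_z^{-\alpha}}\le C|x-y|^\theta$ for all $x,y\in\mathbb R$. Then $U_0^g(t,x)$ is mean-square Hölder continuous in $x$ of any order $\gamma_x\in(0,\theta)$, and it has a continuous modification whose sample paths are almost surely Hölder continuous in $x$ of order $\gamma_x$. (ii) If there exist $\theta^*>0$ and $C>0$ with $\|(-\Delta)_z^{(\kappa_0-1)/4}(g(z,x)-g(z,y))\|_{H_z^{-\alpha}}\le C|x-y|^{\theta^*}$ for all $x,y\in\mathbb R$, then $\tilde U_0^g(t,x)$ is mean-square Hölder continuous in $x$ and admits a modification with almost surely continuous sample paths in $x$ that are Hölder continuous of order $\gamma_x\in(0,\theta^*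 )$.
   Context: $E_\beta(s)=\sum_{k\ge0}s^k/\Gamma(1+\beta k)$ is the Mittag-Leffler function ($E_1(s)=e^s$); $K_\nu$ is the modified Bessel function of the second kind. $W$ is a Gaussian white-noise random measure on $\mathbb R$ with $\mathbb E|W(d\lambda)|^2=d\lambda$, symmetric so that the fields are real-valued. $\widehat g(\lambda,x):=\int_{\mathbb R}e^{-i\lambda x_1}g(x_1,x)dx_1$. For $s\in\mathbb R$, the Sobolev norm in the first variable is $\|g(z,x)\|_{H_z^s}^2:=\int_{\mathbb R}(1+\lambda^2)^s|\widehat g(\lambda,x)|^2d\lambda$. The operator $(-\Delta)_z^{c/2}$ acts in the first variable as the Fourier multiplier $|\lambda|^c$, i.e. $\widehat{(-\Delta)_z^{c/2}g}(\lambda,x)=|\lambda|^c\widehat g(\lambda,x)$. Parameters: $A_0,\dots,A_n\ge0$ with $\sum A_j=1$, $\kappa_0,\dots,\kappa_n\in(0,1)$, $w_1,\dots,w_n>0$; $c_1(\kappa_j):=2^{\mathbf 1_{\{0\}}(j)}2^{(1-\kappa_j)/2}/(\sqrt\pi\,\Gamma(\kappa_j/2))$; $C(\bar\kappa,\bar w,\bar A):=\sum_{j=1}^nc_1(\kappa_j)A_jK_{\frac{\kappa_j-1}2}(w_j)w_j^{\frac{\kappa_j-1}2}$; $C(\kappa_0,A_0):=A_0/(\Gamma(\kappa_0)\cos(\kappa_0\pi/2))$. *)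

theory Defs
  imports "HOL-Probability.Probability"
begin

definition mittag_leffler :: "real \<Rightarrow> real \<Rightarrow> real" where
  "mittag_leffler \<beta> s = (\<Sum>k. s ^ k / Gamma (1 + \<beta> * real k))"

text \<open>Modified Bessel function of the second kind, via the standard integral
  representation K_nu(x) = int_0^infty exp(-x cosh u) cosh(nu u) du  (x > 0).\<close>
definition besselK :: "real \<Rightarrow> real \<Rightarrow> real" where
  "besselK \<nu> x = (LINT u:{0..}|lborel. exp (- x * cosh u) * cosh (\<nu> * u))"

definition c1 :: "nat \<Rightarrow> real \<Rightarrow> real" where
  "c1 j \<kappa> = 2 ^ (if j = 0 then 1 else 0) * 2 powr ((1 - \<kappa>) / 2)
                 / (sqrt pi * Gamma (\<kappa> / 2))"

definition C_kwA :: "nat \<Rightarrow> (nat \<Rightarrow> real) \<Rightarrow> (nat \<Rightarrow> real) \<Rightarrow> (nat \<Rightarrow> real) \<Rightarrow> real" where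
  "C_kwA n \<kappa> w A = (\<Sum>j=1..n. c1 j (\<kappa> j) * A j * besselK ((\<kappa> j - 1) / 2) (w j)
                                 * w j powr ((\<kappa> j - 1) / 2))"

definition C_kA :: "real \<Rightarrow> real \<Rightarrow> real" where
  "C_kA \<kappa>0 A0 = A0 / (Gamma \<kappa>0 * cos (\<kappa>0 * pi / 2))"

definition sq_int :: "(real \<Rightarrow> complex) \<Rightarrow> bool" where
  "sq_int f \<longleftrightarrow> f \<in> borel_measurable lborel \<and>
     (\<integral>\<^sup>+ l. ennreal ((cmod (f l))\<^sup>2) \<partial>lborel) < \<infinity>"

text \<open>F is the (L2 / Plancherel) Fourier transform of f in L2(R), with the convention
  hat f(l) = int exp(-i l x) f(x) dx, i.e. the L2-limit of the truncated integrals.\<close>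
definition fourier_L2 :: "(real \<Rightarrow> real) \<Rightarrow> (real \<Rightarrow> complex) \<Rightarrow> bool" where
  "fourier_L2 f F \<longleftrightarrow> F \<in> borel_measurable lborel \<and>
     ((\<lambda>R. \<integral>\<^sup>+ l. ennreal ((cmod (F l -
         (LINT x:{-R..R}|lborel. exp (- (\<i> * complex_of_real (l * x))) * complex_of_real (f x))))\<^sup>2)
       \<partial>lborel) \<longlongrightarrow> 0) at_top"

text \<open>Squared Sobolev norm of order s, expressed through the Fourier transform F of the
  function: ||h||^2_{H^s} = int (1+l^2)^s |hat h(l)|^2 dl  (value in [0,infinity]).\<close>
definition sobolev_sq :: "real \<Rightarrow> (real \<Rightarrow> complex) \<Rightarrow> ennreal" where
  "sobolev_sq s F = (\<integral>\<^sup>+ l. ennreal ((1 + l\<^sup>2) powr s * (cmod (F l))\<^sup>2) \<partial>lborel)"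

text \<open>Admissible integrands for the white-noise integral: square integrable and
  Hermitian (f(-l) = conj f(l) a.e.), so that the integral is real.\<close>
definition L2herm :: "(real \<Rightarrow> complex) \<Rightarrow> bool" where
  "L2herm f \<longleftrightarrow> sq_int f \<and> (AE l in lborel. f (- l) = cnj (f l))"

text \<open>I f = int f(l) W(dl), the Wiener integral w.r.t. a symmetric complex Gaussian white
  noise W with E|W(dl)|^2 = dl: a linear map from Hermitian L2 functions to centred real
  Gaussian random variables with variance int |f|^2 (isonormal process).\<close>
definition white_noise_integral :: "'a measure \<Rightarrow> ((real \<Rightarrow> complex) \<Rightarrow> 'a \<Rightarrow> real) \<Rightarrow> bool" where
  "white_noise_integral M I \<longleftrightarrow> prob_space M \<and>
     (\<forall>f. L2herm f \<longrightarrow> I f \<in> borel_measurable M) \<and>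
     (\<forall>f g c. L2herm f \<longrightarrow> L2herm g \<longrightarrow>
        (AE \<omega> in M. I (\<lambda>l. f l + complex_of_real c * g l) \<omega> = I f \<omega> + c * I g \<omega>)) \<and>
     (\<forall>f. L2herm f \<longrightarrow>
        (let v = (LINT l|lborel. (cmod (f l))\<^sup>2) in
          (if v = 0 then (AE \<omega> in M. I f \<omega> = 0)
           else distributed M lborel (I f) (normal_density 0 (sqrt v)))))"

definition mlf_field ::
  "((real \<Rightarrow> complex) \<Rightarrow> 'a \<Rightarrow> real) \<Rightarrow> real \<Rightarrow> (real \<Rightarrow> real) \<Rightarrow> (real \<Rightarrow> real \<Rightarrow> complex)
   \<Rightarrow> real \<Rightarrow> real \<Rightarrow> real \<Rightarrow> real \<Rightarrow> real \<Rightarrow> 'a \<Rightarrow> real" where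
  "mlf_field I c m ghat \<beta> \<mu> \<alpha> t x =
     (\<lambda>\<omega>. sqrt c * I (\<lambda>l. ghat l x *
        complex_of_real (mittag_leffler \<beta> (- \<mu> * t powr \<beta> * \<bar>l\<bar> powr \<alpha>) * m l)) \<omega>)"

definition ms_holder :: "'a measure \<Rightarrow> real \<Rightarrow> (real \<Rightarrow> 'a \<Rightarrow> real) \<Rightarrow> bool" where
  "ms_holder M \<gamma> X \<longleftrightarrow> (\<exists>C. \<forall>x y. \<bar>x - y\<bar> \<le> 1 \<longrightarrow>
     (\<integral>\<^sup>+ \<omega>. ennreal ((X x \<omega> - X y \<omega>)\<^sup>2) \<partial>M) \<le> ennreal (C * \<bar>x - y\<bar> powr (2 * \<gamma>)))"

definition locally_holder :: "real \<Rightarrow> (real \<Rightarrow> real) \<Rightarrow> bool" where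
  "locally_holder \<gamma> f \<longleftrightarrow> (\<forall>R>0. \<exists>L. \<forall>x\<in>{-R..R}. \<forall>y\<in>{-R..R}.
     \<bar>f x - f y\<bar> \<le> L * \<bar>x - y\<bar> powr \<gamma>)"

definition holder_modification :: "'a measure \<Rightarrow> real \<Rightarrow> (real \<Rightarrow> 'a \<Rightarrow> real) \<Rightarrow> bool" where
  "holder_modification M \<gamma> X \<longleftrightarrow> (\<exists>V. (\<forall>x. V x \<in> borel_measurable M) \<and>
     (\<forall>x. AE \<omega> in M. V x \<omega> = X x \<omega>) \<and>
     (AE \<omega> in M. continuous_on UNIV (\<lambda>x. V x \<omega>) \<and> locally_holder \<gamma> (\<lambda>x. V x \<omega>)))"

end

theory Submission
  imports Defs "HOL-Real_Asymp.Real_Asymp"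
begin

text \<open>An increment of either field is a centred Gaussian variable with variance proportional to
  the integral of |ghat(l,x) - ghat(l,y)|^2 m(l)^2 E(-a |l|^\<alpha>)^2, where a = \<mu> t^\<beta>. The bound
  0 \<le> E(-s) \<le> 1 / (1 + s / \<Gamma>(1+\<beta>)) for the Mittag-Leffler function E dominates the last factor by a
  multiple of (1 + l^2)^-\<alpha>, so the variance is controlled by the Sobolev norm of order -\<alpha>, that is,
  by |x - y|^(2 \<theta>). Gaussian moments of high even order then turn this into pathwise regularity
  by the Kolmogorov-Chentsov argument.

  For the Mittag-Leffler bound, discretize the fractional relaxation equation D^\<beta> u = -u with a step
  proportional to 1/n. The discrete solution is given by a power series in (1 - X)^-\<beta> whose
  coefficients are visibly nonnegative and decreasing; inserting this into the discrete Volterra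
  equation gives the bound, and the n-th value at step size s^(1/\<beta>) / n tends to E(-s) by Gauss's
  product for the Gamma function.\<close>

section \<open>The Mittag-Leffler function on the negative axis\<close>

text \<open>The coefficient of X^n in (1 - X)^-a. The parameter 1 + b gives the discrete counterpart
  of t^b / Gamma (1 + b), the powers out of which the Mittag-Leffler series is built.\<close>

definition rising_coeff :: "real \<Rightarrow> nat \<Rightarrow> real" where
  "rising_coeff a n = pochhammer a n / fact n"

definition rising_fps :: "real \<Rightarrow> real fps" where
  "rising_fps a = Abs_fps (rising_coeff a)"

lemma rising_fps_nth [simp]: "fps_nth (rising_fps a) n = rising_coeff a n"
  by (simp add: rising_fps_def)

lemma rising_coeff_0 [simp]: "rising_coeff a 0 = 1"
  by (simp add: rising_coeff_def)

lemma rising_coeff_1 [simp]: "rising_coeff 1 n = 1"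
  by (simp add: rising_coeff_def flip: pochhammer_fact)

lemma rising_coeff_Suc: "rising_coeff a (Suc n) = rising_coeff a n * (a + real n) / real (Suc n)"
  by (simp add: rising_coeff_def pochhammer_Suc field_simps)

lemma rising_coeff_nonneg: "0 \<le> a \<Longrightarrow> 0 \<le> rising_coeff a n"
  by (induction n) (simp_all add: rising_coeff_Suc)

text \<open>Exponents of 1 - X add. Up to the sign (-1)^n the coefficients are binomial coefficients
  with upper entry -a, so this is Vandermonde's convolution.\<close>

lemma rising_fps_mult: "rising_fps a * rising_fps b = rising_fps (a + b)"
proof (rule fps_ext)
  fix n
  have c: "rising_coeff x k = (-1) ^ k * ((-x) gchoose k)" for x k
    by (simp add: rising_coeff_def gbinomial_pochhammer flip: power_add mult.assoc)
  have "fps_nth (rising_fps a * rising_fps b) n = (\<Sum>k=0..n. (-1)^n * (((-a) gchoose k) * ((-b) gchoose (n - k))))"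
    unfolding fps_mult_nth rising_fps_nth c
  proof (intro sum.cong refl)
    fix k assume "k \<in> {0..n}"
    then have "(-1::real) ^ n = (-1) ^ k * (-1) ^ (n - k)"
      by (simp flip: power_add)
    then show "(-1) ^ k * (- a gchoose k) * ((-1) ^ (n - k) * (- b gchoose (n - k))) =
      (-1) ^ n * ((- a gchoose k) * (- b gchoose (n - k)))" by simp
  qed
  also have "\<dots> = fps_nth (rising_fps (a + b)) n"
    using gbinomial_Vandermonde[of "-a" "-b" n] unfolding rising_fps_nth c
    by (simp flip: sum_distrib_left)
  finally show "fps_nth (rising_fps a * rising_fps b) n = fps_nth (rising_fps (a + b)) n" .
qed

lemma rising_fps_0: "rising_fps 0 = 1"
  by (rule fps_ext) (simp add: rising_coeff_def pochhammer_0_left)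

lemma rising_fps_minus_1: "rising_fps (-1) = 1 - fps_X"
proof (rule fps_ext)
  fix n
  have "rising_coeff (-1) (Suc (Suc m)) = 0" for m
    by (simp add: rising_coeff_def pochhammer_rec)
  moreover have "rising_coeff (-1) (Suc 0) = -1"
    by (simp add: rising_coeff_Suc)
  ultimately show "fps_nth (rising_fps (-1)) n = fps_nth (1 - fps_X) n"
    by (cases n; cases "n - 1") auto
qed

text \<open>In \<open>pochhammer (-\<beta>) n\<close> only the leading factor -\<beta> can be
  negative; the others start at 1 - \<beta>. This sign is what keeps the coefficients of 1 / ((1 -
  X)^\<beta> + r) nonnegative.\<close>

lemma rising_coeff_nonpos:
  assumes "0 \<le> \<beta>" "\<beta> \<le> 1" "n > 0"
  shows "rising_coeff (-\<beta>) n \<le> 0"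
proof -
  obtain m where m: "n = Suc m" using assms(3) by (cases n) auto
  have "pochhammer (1 - \<beta>) m = rising_coeff (1 - \<beta>) m * fact m"
    by (simp add: rising_coeff_def)
  then have "0 \<le> pochhammer (1 - \<beta>) m"
    using rising_coeff_nonneg[of "1 - \<beta>" m] assms by simp
  then show ?thesis
    using assms(1) by (simp add: m rising_coeff_def pochhammer_rec divide_nonpos_pos mult_nonneg_nonneg)
qed

text \<open>With (1 - X)^-a = rising_fps a, the hypothesis reads
  U = (1 - X)^(\<beta>-1) D, where D = 1 / ((1 - X)^\<beta> + r).
  Both factors have nonnegative coefficients, and (1 - X) U = 1 - r D.\<close>
lemma discrete_relaxation_bounds:
  assumes \<beta>: "0 \<le> \<beta>" "\<beta> \<le> 1" and r: "r \<ge> 0"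
    and U: "U * (1 + fps_const r * rising_fps \<beta>) = rising_fps 1"
  shows "0 \<le> fps_nth U n" and "fps_nth U (Suc n) \<le> fps_nth U n"
proof -
  define Q where "Q = fps_const r + rising_fps (-\<beta>)"
  define D where "D = inverse Q"
  have Q0: "fps_nth Q 0 = 1 + r" by (simp add: Q_def)
  then have "fps_nth Q 0 \<noteq> 0" using r by simp
  then have DQ: "D * Q = 1" unfolding D_def by (rule inverse_mult_eq_1)
  \<comment> \<open>Comparing coefficients in \<open>D * Q = 1\<close> gives a recursion for
    \<open>D\<close> whose leading coefficient 1 + r is positive and whose other weights, the
    coefficients of (1 - X)^\<beta> of positive index, are nonpositive; so strong induction
    applies.\<close>
  have D: "0 \<le> fps_nth D n" for n
  proof (induction n rule: less_induct)
    case (less n)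
    have D0: "fps_nth D 0 * (1 + r) = 1"
      using arg_cong[OF DQ, of "\<lambda>f. fps_nth f 0"] Q0 by simp
    show ?case
    proof (cases "n = 0")
      case True
      have "fps_nth D 0 = 1 / (1 + r)" using D0 r by (simp add: field_simps)
      then show ?thesis using True r by simp
    next
      case False
      have "0 = (\<Sum>i=0..n. fps_nth D i * fps_nth Q (n - i))"
        using arg_cong[OF DQ, of "\<lambda>f. fps_nth f n"] False by (simp add: fps_mult_nth)
      also have "\<dots> = fps_nth D n * (1 + r) + (\<Sum>i=0..<n. fps_nth D i * fps_nth Q (n - i))"
        using Q0 by (simp add: sum.last_plus)
      finally have eq: "fps_nth D n * (1 + r) = - (\<Sum>i=0..<n. fps_nth D i * fps_nth Q (n - i))"
        by simp
      have "(\<Sum>i=0..<n. fps_nth D i * fps_nth Q (n - i)) \<le> 0"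
      proof (rule sum_nonpos)
        fix i assume i: "i \<in> {0..<n}"
        then have "fps_nth Q (n - i) = rising_coeff (-\<beta>) (n - i)" by (auto simp: Q_def)
        then show "fps_nth D i * fps_nth Q (n - i) \<le> 0"
          using less.IH[of i] i rising_coeff_nonpos[OF \<beta>, of "n - i"] by (simp add: mult_nonneg_nonpos)
      qed
      then have "0 \<le> fps_nth D n * (1 + r)" using eq by simp
      then show ?thesis using r by (simp add: zero_le_mult_iff)
    qed
  qed
  \<comment> \<open>Multiplying the hypothesis on \<open>U\<close> by (1 - X)^\<beta> turns its
    factor into \<open>Q\<close>, and multiplying by \<open>D\<close> then solves for
    \<open>U\<close>.\<close>
  have "rising_fps (-\<beta>) * rising_fps \<beta> = 1"
    by (simp add: rising_fps_mult rising_fps_0)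
  then have "rising_fps (-\<beta>) * (1 + fps_const r * rising_fps \<beta>) = Q"
    by (simp add: Q_def algebra_simps)
  then have "U * Q = rising_fps (-\<beta>) * rising_fps 1" using U by (metis mult.left_commute)
  then have UQ: "U * Q = rising_fps (1 - \<beta>)" by (simp add: rising_fps_mult)
  then have UD: "U = rising_fps (1 - \<beta>) * D"
    using DQ by (metis mult.assoc mult.commute mult.right_neutral)
  show "0 \<le> fps_nth U n"
    unfolding UD fps_mult_nth using D rising_coeff_nonneg[of "1-\<beta>"] \<beta> by (simp add: sum_nonneg)
  have "(1 - fps_X) * U = rising_fps (-1) * rising_fps (1 - \<beta>) * D"
    unfolding UD rising_fps_minus_1 by (simp only: mult.assoc)
  also have "\<dots> = rising_fps (-\<beta>) * D" by (simp add: rising_fps_mult)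
  also have "\<dots> = (Q - fps_const r) * D" by (simp add: Q_def)
  also have "\<dots> = 1 - fps_const r * D" using DQ by (simp add: algebra_simps)
  finally have "fps_nth ((1 - fps_X) * U) (Suc n) = fps_nth (1 - fps_const r * D) (Suc n)" by simp
  then have "fps_nth U (Suc n) - fps_nth U n = - r * fps_nth D (Suc n)"
    by (simp add: algebra_simps)
  then show "fps_nth U (Suc n) \<le> fps_nth U n"
    using D[of "Suc n"] r by (smt (verit) mult_minus_left mult_nonneg_nonneg)
qed

text \<open>Each factor 1 + a / (m + 1) is at most 1 + a. Taking a = \<beta> k with n fixed gives
  polynomial growth in k, which a geometric factor q^k absorbs.\<close>

lemma rising_coeff_le_power: "0 \<le> a \<Longrightarrow> rising_coeff (1 + a) n \<le> (1 + a) ^ n"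
proof (induction n)
  case (Suc n)
  have "rising_coeff (1 + a) (Suc n) = rising_coeff (1 + a) n * ((1 + a + real n) / real (Suc n))"
    by (simp add: rising_coeff_Suc)
  also have "\<dots> \<le> (1 + a) ^ n * (1 + a)"
    using Suc by (intro mult_mono) (auto simp: field_simps)
  finally show ?case by (simp only: power_Suc2)
qed simp

lemma summable_power_times_polynomial:
  fixes q :: real
  assumes "\<bar>q\<bar> < 1"
  shows "summable (\<lambda>k. (1 + real k) ^ n * q ^ k)"
proof -
  have "(\<lambda>k. \<bar>q\<bar> * ((2 + real k) / (1 + real k)) ^ n) \<longlonglongrightarrow> \<bar>q\<bar> * 1 ^ n"
    by (intro tendsto_intros) real_asymp
  then have "\<forall>\<^sub>F k in sequentially. \<bar>q\<bar> * ((2 + real k) / (1 + real k)) ^ n < (1 + \<bar>q\<bar>) / 2"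
    by (rule order_tendstoD) (use assms in auto)
  then obtain N where N: "\<bar>q\<bar> * ((2 + real k) / (1 + real k)) ^ n < (1 + \<bar>q\<bar>) / 2" if "k \<ge> N" for k
    by (auto simp: eventually_sequentially)
  show ?thesis
  proof (rule summable_ratio_test)
    show "(1 + \<bar>q\<bar>) / 2 < 1" using assms by simp
    fix k assume "k \<ge> N"
    have "norm ((1 + real (Suc k)) ^ n * q ^ Suc k) =
        (\<bar>q\<bar> * ((2 + real k) / (1 + real k)) ^ n) * ((1 + real k) ^ n * \<bar>q\<bar> ^ k)"
      by (simp add: abs_mult power_abs power_divide)
    also have "\<dots> \<le> (1 + \<bar>q\<bar>) / 2 * ((1 + real k) ^ n * \<bar>q\<bar> ^ k)"
      using N[OF \<open>k \<ge> N\<close>] by (intro mult_right_mono) auto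
    finally show "norm ((1 + real (Suc k)) ^ n * q ^ Suc k) \<le> (1 + \<bar>q\<bar>) / 2 * norm ((1 + real k) ^ n * q ^ k)"
      by (simp add: abs_mult power_abs)
  qed
qed

lemma summable_rising_coeff:
  assumes "0 \<le> \<beta>" "\<beta> \<le> 1" "\<bar>q\<bar> < 1"
  shows "summable (\<lambda>k. q ^ k * rising_coeff (1 + \<beta> * real k) n)"
proof (rule summable_comparison_test')
  show "summable (\<lambda>k. (1 + real k) ^ n * \<bar>q\<bar> ^ k)"
    using assms by (intro summable_power_times_polynomial) simp
  fix k :: nat assume "k \<ge> 0"
  have "rising_coeff (1 + \<beta> * real k) n \<le> (1 + \<beta> * real k) ^ n"
    using assms by (intro rising_coeff_le_power) simp
  also have "\<dots> \<le> (1 + real k) ^ n"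
    using assms by (intro power_mono add_mono mult_left_le_one_le) auto
  finally show "norm (q ^ k * rising_coeff (1 + \<beta> * real k) n) \<le> (1 + real k) ^ n * \<bar>q\<bar> ^ k"
    using rising_coeff_nonneg[of "1 + \<beta> * real k" n] assms
    by (simp add: abs_mult power_abs mult.commute mult_left_mono)
qed

section \<open>The discrete relaxation sequence and its bounds\<close>

lemma fps_mult_affine_nth:
  fixes f g :: "'a :: comm_ring_1 fps"
  shows "fps_nth (f * (1 + fps_const r * g)) n =
    fps_nth f n + r * (\<Sum>i=0..n. fps_nth f i * fps_nth g (n - i))"
proof -
  have "f * (1 + fps_const r * g) = f + fps_const r * (f * g)"
    by (simp add: distrib_left mult.left_commute)
  then show ?thesis by (simp add: fps_mult_nth[of f g])
qed

text \<open>The generating function (1 - X)^-1 / (1 + r (1 - X)^-\<beta>) expanded as a geometric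
  series in r, read off at X^n. It solves the Volterra equation u + r J u = 1, where J, convolution
  with \<open>rising_coeff \<beta>\<close>, discretizes the fractional integral of order
  \<beta>.\<close>

definition relaxation_seq :: "real \<Rightarrow> real \<Rightarrow> nat \<Rightarrow> real" where
  "relaxation_seq \<beta> r n = (\<Sum>k. (-r) ^ k * rising_coeff (1 + \<beta> * real k) n)"

text \<open>Convolution with the coefficients of (1 - X)^-\<beta> raises k by one in every term of
  the series; the sums therefore cancel and only the term k = 0, the constant sequence 1,
  remains.\<close>

lemma relaxation_seq_fps:
  assumes "0 \<le> \<beta>" "\<beta> \<le> 1" "0 \<le> r" "r < 1"
  shows "Abs_fps (relaxation_seq \<beta> r) * (1 + fps_const r * rising_fps \<beta>) = rising_fps 1"
proof (rule fps_ext)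
  fix n
  let ?t = "\<lambda>k n. (-r) ^ k * rising_coeff (1 + \<beta> * real k) n"
  have sm: "summable (\<lambda>k. ?t k i)" for i
    using assms by (intro summable_rising_coeff) auto
  have "(\<Sum>i=0..n. relaxation_seq \<beta> r i * rising_coeff \<beta> (n - i)) =
      (\<Sum>k. \<Sum>i=0..n. ?t k i * rising_coeff \<beta> (n - i))"
    unfolding relaxation_seq_def
    using sm by (subst suminf_sum) (auto intro: summable_mult2 simp: suminf_mult2)
  also have "(\<lambda>k. \<Sum>i=0..n. ?t k i * rising_coeff \<beta> (n - i)) =
      (\<lambda>k. (-r) ^ k * rising_coeff (1 + \<beta> * real (Suc k)) n)"
  proof
    fix k
    have "(\<Sum>i=0..n. ?t k i * rising_coeff \<beta> (n - i)) =
        (-r) ^ k * fps_nth (rising_fps (1 + \<beta> * real k) * rising_fps \<beta>) n"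
      by (simp add: fps_mult_nth sum_distrib_left mult.assoc)
    then show "(\<Sum>i=0..n. ?t k i * rising_coeff \<beta> (n - i)) =
        (-r) ^ k * rising_coeff (1 + \<beta> * real (Suc k)) n"
      by (simp add: rising_fps_mult algebra_simps)
  qed
  finally have conv: "(\<Sum>i=0..n. relaxation_seq \<beta> r i * rising_coeff \<beta> (n - i)) =
      (\<Sum>k. (-r) ^ k * rising_coeff (1 + \<beta> * real (Suc k)) n)" .
  have "relaxation_seq \<beta> r n = 1 + (\<Sum>k. ?t (Suc k) n)"
    unfolding relaxation_seq_def by (subst suminf_split_head[OF sm]) simp
  also have "(\<Sum>k. ?t (Suc k) n) = -r * (\<Sum>k. (-r) ^ k * rising_coeff (1 + \<beta> * real (Suc k)) n)"
  \<comment> \<open>Summability of the index-shifted series is obtained from the original one by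
    dividing by -r, hence the separate case r = 0.\<close>
  proof (cases "r = 0")
    case False
    then have "summable (\<lambda>k. (-r) ^ k * rising_coeff (1 + \<beta> * real (Suc k)) n)"
      using summable_mult[OF summable_Suc_iff[THEN iffD2, OF sm[of n]], of "-1/r"] by simp
    from suminf_mult[OF this, of "-r"] show ?thesis by (simp add: mult.assoc)
  qed simp
  finally have "relaxation_seq \<beta> r n +
     r * (\<Sum>i=0..n. relaxation_seq \<beta> r i * rising_coeff \<beta> (n - i)) = 1"
    unfolding conv by simp
  then show "fps_nth (Abs_fps (relaxation_seq \<beta> r) * (1 + fps_const r * rising_fps \<beta>)) n = fps_nth (rising_fps 1) n"
    by (simp add: fps_mult_affine_nth)
qed

text \<open>The sequence is decreasing, so its last value bounds the convolution in the Volterra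
  equation from below: u_n times the sum of the kernel coefficients up to n, which is
  \<open>rising_coeff (1 + \<beta>) n\<close> because multiplication by (1 - X)^-1 forms partial
  sums.\<close>

lemma relaxation_seq_bounds:
  assumes "0 \<le> \<beta>" "\<beta> \<le> 1" "0 \<le> r" "r < 1"
  shows "0 \<le> relaxation_seq \<beta> r n"
    and "relaxation_seq \<beta> r n * (1 + r * rising_coeff (1 + \<beta>) n) \<le> 1"
proof -
  let ?u = "relaxation_seq \<beta> r"
  note U = relaxation_seq_fps[OF assms]
  note b = discrete_relaxation_bounds[OF assms(1-3) U, unfolded fps_nth_Abs_fps]
  show "0 \<le> ?u n" by (rule b)
  have dec: "?u n \<le> ?u i" if "i \<le> n" for i
    using b(2) that by (rule lift_Suc_antimono_le[of ?u])
  have "rising_coeff (1 + \<beta>) n = fps_nth (rising_fps 1 * rising_fps \<beta>) n"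
    by (simp add: rising_fps_mult)
  also have "\<dots> = (\<Sum>i=0..n. rising_coeff \<beta> (n - i))" by (simp add: fps_mult_nth)
  finally have "?u n * rising_coeff (1 + \<beta>) n \<le> (\<Sum>i=0..n. ?u i * rising_coeff \<beta> (n - i))"
    using dec rising_coeff_nonneg[OF assms(1)] by (auto simp: sum_distrib_left intro!: sum_mono mult_right_mono)
  then have "?u n + r * (?u n * rising_coeff (1 + \<beta>) n) \<le> ?u n + r * (\<Sum>i=0..n. ?u i * rising_coeff \<beta> (n - i))"
    using assms(3) by (intro add_left_mono mult_left_mono) auto
  also have "\<dots> = fps_nth (Abs_fps ?u * (1 + fps_const r * rising_fps \<beta>)) n"
    by (simp add: fps_mult_affine_nth)
  also have "\<dots> = 1" unfolding U by simp
  finally show "?u n * (1 + r * rising_coeff (1 + \<beta>) n) \<le> 1" by (simp add: algebra_simps)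
qed

text \<open>The quotient of successive values of \<open>rising_coeff (1 + a)\<close> is 1 + a / (k +
  1), at most exp (a / (k + 1)) and hence at most ((k + 1) / k)^a. The monotonicity later supplies a
  dominating series that does not depend on n.\<close>

lemma rising_coeff_over_powr_antimono:
  assumes a: "0 \<le> a" and "0 < m" "m \<le> n"
  shows "rising_coeff (1 + a) n / real n powr a \<le> rising_coeff (1 + a) m / real m powr a"
  using assms(3)
proof (induction n rule: dec_induct)
  case (step k)
  then have k: "k > 0" using assms(2) by simp
  have "1 + a / real (Suc k) \<le> exp (a / real (Suc k))" by (rule exp_ge_add_one_self)
  also have "\<dots> \<le> exp (a * ln (real (Suc k) / real k))"
  proof -
    have "ln (real k / real (Suc k)) \<le> real k / real (Suc k) - 1"
      using k by (intro ln_le_minus_one) simp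
    also have "\<dots> = - 1 / real (Suc k)" by (simp add: field_simps)
    finally have "1 / real (Suc k) \<le> ln (real (Suc k) / real k)"
      using k by (simp add: ln_div)
    then show ?thesis using mult_left_mono[OF _ a] by fastforce
  qed
  also have "\<dots> = (real (Suc k) / real k) powr a" using k by (simp add: powr_def)
  also have "\<dots> = real (Suc k) powr a / real k powr a" by (simp add: powr_divide)
  finally have "(1 + a / real (Suc k)) / real (Suc k) powr a \<le>
      (real (Suc k) powr a / real k powr a) / real (Suc k) powr a"
    by (intro divide_right_mono) auto
  then have le: "(1 + a / real (Suc k)) / real (Suc k) powr a \<le> 1 / real k powr a" by simp
  have "rising_coeff (1 + a) (Suc k) / real (Suc k) powr a =
      rising_coeff (1 + a) k * ((1 + a / real (Suc k)) / real (Suc k) powr a)"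
    by (simp add: rising_coeff_Suc field_simps)
  also have "\<dots> \<le> rising_coeff (1 + a) k * (1 / real k powr a)"
    using le rising_coeff_nonneg[of "1 + a" k] a by (intro mult_left_mono) auto
  finally show ?case using step.IH by simp
qed simp

text \<open>This is Gauss's product: \<open>Gamma_series'\<close> carries (n - 1)! and n^(1 + a)
  where the quotient here has n! and n^a, and the extra factors n cancel for n > 0.\<close>

lemma rising_coeff_over_powr_tendsto:
  assumes "0 \<le> a"
  shows "(\<lambda>n. rising_coeff (1 + a) n / real n powr a) \<longlonglongrightarrow> 1 / Gamma (1 + a)"
proof -
  have "Gamma (1 + a) > 0" using assms by (intro Gamma_real_pos) simp
  then have "(\<lambda>n. 1 / Gamma_series' (1 + a) n) \<longlonglongrightarrow> 1 / Gamma (1 + a)"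
    by (intro tendsto_intros Gamma_series'_LIMSEQ) auto
  moreover have "\<forall>\<^sub>F n in sequentially. 1 / Gamma_series' (1 + a) n = rising_coeff (1 + a) n / real n powr a"
    using eventually_gt_at_top[of 0]
  proof eventually_elim
    case (elim n)
    then have "fact n = real n * fact (n - 1)" by (simp add: fact_reduce)
    then show ?case
      using elim by (simp add: Gamma_series'_def rising_coeff_def powr_def distrib_right exp_add mult.commute)
  qed
  ultimately show ?thesis by (rule Lim_transform_eventually)
qed

text \<open>Over n steps of size s^(1/\<beta>) / n, whose \<beta>-th power is
  \<open>s / real n powr \<beta>\<close>, the k-th term becomes (-s)^k times a normalized
  coefficient with limit 1 / Gamma (1 + \<beta> k). Tannery's theorem exchanges this limit with the
  sum over k.\<close>

theorem relaxation_seq_tendsto_mittag_leffler: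
  assumes \<beta>: "0 < \<beta>" "\<beta> \<le> 1" and s: "0 \<le> s"
  shows "(\<lambda>n. relaxation_seq \<beta> (s / real n powr \<beta>) n) \<longlonglongrightarrow> mittag_leffler \<beta> (- s)"
proof -
  let ?a = "\<lambda>k n. (- (s / real n powr \<beta>)) ^ k * rising_coeff (1 + \<beta> * real k) n"
  have "filterlim (\<lambda>n. real n powr \<beta>) at_top sequentially"
    using \<beta> by real_asymp
  then have "\<forall>\<^sub>F n in sequentially. s < real n powr \<beta>"
    by (simp add: filterlim_at_top_dense)
  then have "\<forall>\<^sub>F n in sequentially. s < real n powr \<beta> \<and> 0 < n"
    by (intro eventually_conj eventually_gt_at_top)
  \<comment> \<open>For r = s / N^\<beta> < 1 the series at index \<open>N\<close> converges
    absolutely, and by monotonicity its terms dominate those at all n \<ge> N.\<close>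
  then obtain N where N: "s < real N powr \<beta>" "0 < N"
    by (auto simp: eventually_sequentially)
  have alt: "?a k n = (- s) ^ k * (rising_coeff (1 + \<beta> * real k) n / real n powr (\<beta> * real k))" if "n > 0" for k n
  proof -
    have "(real n powr \<beta>) ^ k = real n powr (\<beta> * real k)"
      using that by (simp flip: powr_realpow add: powr_powr)
    then show ?thesis by (simp add: power_divide flip: divide_minus_left)
  qed
  have "((\<lambda>n. \<Sum>k. ?a k n) \<longlongrightarrow> (\<Sum>k. (- s) ^ k * (1 / Gamma (1 + \<beta> * real k)))) sequentially"
  proof (rule tannerys_theorem[THEN conjunct2, THEN conjunct2])
    show "(\<lambda>n. ?a k n) \<longlonglongrightarrow> (- s) ^ k * (1 / Gamma (1 + \<beta> * real k))" for k
    proof (rule Lim_transform_eventually)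
      show "(\<lambda>n. (- s) ^ k * (rising_coeff (1 + \<beta> * real k) n / real n powr (\<beta> * real k)))
          \<longlonglongrightarrow> (- s) ^ k * (1 / Gamma (1 + \<beta> * real k))"
        using \<beta> by (intro tendsto_intros rising_coeff_over_powr_tendsto) auto
      show "\<forall>\<^sub>F n in sequentially. (- s) ^ k * (rising_coeff (1 + \<beta> * real k) n / real n powr (\<beta> * real k)) = ?a k n"
        using eventually_gt_at_top[of 0] by eventually_elim (simp add: alt)
    qed
    show "\<forall>\<^sub>F (k, n) in at_top \<times>\<^sub>F sequentially. norm (?a k n) \<le> norm (?a k N)"
    proof -
      have "norm (?a k n) \<le> norm (?a k N)" if "n \<ge> N" for k n
      proof -
        have "rising_coeff (1 + \<beta> * real k) n / real n powr (\<beta> * real k) \<le>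
            rising_coeff (1 + \<beta> * real k) N / real N powr (\<beta> * real k)"
          using \<beta> N that by (intro rising_coeff_over_powr_antimono) auto
        then have "s ^ k * (rising_coeff (1 + \<beta> * real k) n / real n powr (\<beta> * real k)) \<le>
          s ^ k * (rising_coeff (1 + \<beta> * real k) N / real N powr (\<beta> * real k))"
          using s by (intro mult_left_mono) auto
        then show ?thesis
          unfolding alt[OF N(2)] alt[OF less_le_trans[OF N(2) that]]
          using s \<beta> rising_coeff_nonneg[of "1 + \<beta> * real k"] by (simp add: abs_mult power_abs)
      qed
      then show ?thesis
        unfolding eventually_prod_filter
        by (intro exI[of _ "\<lambda>_. True"] exI[of _ "\<lambda>n. n \<ge> N"]) (auto simp: eventually_ge_at_top)
    qed
    show "summable (\<lambda>k. norm (?a k N))"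
    proof -
      have "summable (\<lambda>k. (s / real N powr \<beta>) ^ k * rising_coeff (1 + \<beta> * real k) N)"
        using \<beta> s N by (intro summable_rising_coeff) auto
      then show ?thesis
        using s \<beta> rising_coeff_nonneg[of "1 + \<beta> * real k" for k] by (simp add: abs_mult power_abs)
    qed
  qed simp
  then show ?thesis by (simp add: relaxation_seq_def mittag_leffler_def)
qed

text \<open>Both bounds are inherited from the discrete solution, where the condition r < 1 holds
  for all large n. The decay of order 1 / s is what produces the Sobolev order -\<alpha> once s is a
  multiple of |l|^\<alpha>.\<close>

theorem mittag_leffler_bounds:
  assumes \<beta>: "0 < \<beta>" "\<beta> \<le> 1" and s: "0 \<le> s"
  shows "0 \<le> mittag_leffler \<beta> (- s)" and "mittag_leffler \<beta> (- s) \<le> 1 / (1 + s / Gamma (1 + \<beta>))"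
proof -
  let ?u = "\<lambda>n. relaxation_seq \<beta> (s / real n powr \<beta>) n"
  note lim = relaxation_seq_tendsto_mittag_leffler[OF assms]
  have "filterlim (\<lambda>n. real n powr \<beta>) at_top sequentially"
    using \<beta> by real_asymp
  then have "\<forall>\<^sub>F n in sequentially. s < real n powr \<beta>"
    by (simp add: filterlim_at_top_dense)
  then have "\<forall>\<^sub>F n in sequentially. s / real n powr \<beta> < 1"
  proof eventually_elim
    case (elim n)
    then show ?case using s by (cases "n = 0") (auto simp: divide_less_eq_1_pos)
  qed
  then have ev: "\<forall>\<^sub>F n in sequentially. 0 \<le> ?u n \<and>
      ?u n * (1 + s * (rising_coeff (1 + \<beta>) n / real n powr \<beta>)) \<le> 1"
  proof eventually_elim
    case (elim n)
    then show ?case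
      using relaxation_seq_bounds[of \<beta> "s / real n powr \<beta>" n] \<beta> s by simp
  qed
  show "0 \<le> mittag_leffler \<beta> (- s)"
    by (rule tendsto_lowerbound[OF lim]) (use ev in \<open>auto elim: eventually_mono\<close>)
  have "(\<lambda>n. ?u n * (1 + s * (rising_coeff (1 + \<beta>) n / real n powr \<beta>)))
      \<longlonglongrightarrow> mittag_leffler \<beta> (- s) * (1 + s * (1 / Gamma (1 + \<beta>)))"
    using \<beta> by (intro tendsto_intros lim rising_coeff_over_powr_tendsto) auto
  then have "mittag_leffler \<beta> (- s) * (1 + s * (1 / Gamma (1 + \<beta>))) \<le> 1"
    by (rule tendsto_upperbound) (use ev in \<open>auto elim: eventually_mono\<close>)
  moreover have "Gamma (1 + \<beta>) > 0" using \<beta> by (intro Gamma_real_pos) simp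
  ultimately show "mittag_leffler \<beta> (- s) \<le> 1 / (1 + s / Gamma (1 + \<beta>))"
    using s by (subst pos_le_divide_eq) (auto intro: add_pos_nonneg)
qed

section \<open>The Kolmogorov-Chentsov theorem\<close>

lemma geometric_increments_limit:
  fixes a :: "nat \<Rightarrow> real"
  assumes q: "0 < q" "q < 1"
    and a: "\<And>n. n \<ge> n0 \<Longrightarrow> \<bar>a (Suc n) - a n\<bar> \<le> q ^ Suc n"
  shows "convergent a" and "n \<ge> n0 \<Longrightarrow> \<bar>lim a - a n\<bar> \<le> q ^ n / (1 - q)"
proof -
  \<comment> \<open>Subtracting q^m lets the induction on \<open>m\<close> telescope; the weaker
    bound without it would not survive the addition of one more increment.\<close>
  have est: "\<bar>a m - a n\<bar> \<le> (q ^ n - q ^ m) / (1 - q)" if "n0 \<le> n" "n \<le> m" for m n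
    using that(2)
  proof (induction m rule: dec_induct)
    case (step m)
    have "q * q ^ m * (1 - q) \<le> q ^ m * (1 - q)"
      using q by (intro mult_right_mono mult_left_le_one_le) auto
    then have "q ^ Suc m \<le> (q ^ m - q ^ Suc m) / (1 - q)"
      using q by (simp add: pos_le_divide_eq algebra_simps)
    moreover have "\<bar>a (Suc m) - a m\<bar> \<le> q ^ Suc m" using a step that by simp
    ultimately have "\<bar>a (Suc m) - a n\<bar> \<le> (q ^ n - q ^ m) / (1 - q) + (q ^ m - q ^ Suc m) / (1 - q)"
      using step.IH by linarith
    then show ?case by (simp flip: add_divide_distrib)
  qed simp
  have est': "\<bar>a m - a n\<bar> \<le> q ^ n / (1 - q)" if "n0 \<le> n" "n \<le> m" for m n
  proof -
    have "(q ^ n - q ^ m) / (1 - q) \<le> q ^ n / (1 - q)"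
      using q by (intro divide_right_mono) auto
    then show ?thesis using est[OF that] by linarith
  qed
  have "Cauchy a"
  proof (rule metric_CauchyI)
    fix e :: real assume "e > 0"
    have "(\<lambda>n. q ^ n / (1 - q)) \<longlonglongrightarrow> 0 / (1 - q)"
      using q by (intro tendsto_intros LIMSEQ_realpow_zero) auto
    then have "\<forall>\<^sub>F n in sequentially. q ^ n / (1 - q) < e / 2"
      using \<open>e > 0\<close> by (intro order_tendstoD) auto
    then have "\<forall>\<^sub>F n in sequentially. q ^ n / (1 - q) < e / 2 \<and> n0 \<le> n"
      by (intro eventually_conj eventually_ge_at_top)
    then obtain n where n: "q ^ n / (1 - q) < e / 2" "n0 \<le> n"
      by (auto simp: eventually_sequentially)
    show "\<exists>M. \<forall>m\<ge>M. \<forall>n\<ge>M. dist (a m) (a n) < e"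
    proof (intro exI allI impI)
      fix i j assume "n \<le> i" "n \<le> j"
      then show "dist (a i) (a j) < e"
        using est'[OF n(2), of i] est'[OF n(2), of j] n(1) unfolding dist_real_def by linarith
    qed
  qed
  then show "convergent a" by (rule Cauchy_convergent)
  then have lim: "a \<longlonglongrightarrow> lim a" by (simp add: convergent_LIMSEQ_iff)
  show "\<bar>lim a - a n\<bar> \<le> q ^ n / (1 - q)" if "n \<ge> n0"
  proof (rule LIMSEQ_le_const2)
    show "(\<lambda>m. \<bar>a m - a n\<bar>) \<longlonglongrightarrow> \<bar>lim a - a n\<bar>" by (intro tendsto_intros lim)
    show "\<exists>N. \<forall>m\<ge>N. \<bar>a m - a n\<bar> \<le> q ^ n / (1 - q)" using est'[OF that] by blast
  qed
qed

text \<open>A Hoelder estimate at distances up to d gives continuity, hence boundedness on compact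
  intervals, and boundedness handles pairs farther apart than d at the cost of a constant 2 b /
  d^\<gamma>.\<close>

lemma locally_holder_imp_continuous:
  assumes "\<gamma> > 0" and loc: "\<And>R. R > 0 \<Longrightarrow> \<exists>d>0. \<exists>L. \<forall>x\<in>{-R..R}. \<forall>y\<in>{-R..R}.
    \<bar>x - y\<bar> \<le> d \<longrightarrow> \<bar>f x - f y\<bar> \<le> L * \<bar>x - y\<bar> powr \<gamma>"
  shows "continuous_on UNIV f" and "locally_holder \<gamma> f"
proof -
  have "isCont f x" for x
  proof -
    have "\<bar>x\<bar> + 1 > 0" by linarith
    from loc[OF this] obtain d L where d: "d > 0" and L: "\<And>y z. y \<in> {-(\<bar>x\<bar>+1)..\<bar>x\<bar>+1} \<Longrightarrow> z \<in> {-(\<bar>x\<bar>+1)..\<bar>x\<bar>+1} \<Longrightarrow>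
        \<bar>y - z\<bar> \<le> d \<Longrightarrow> \<bar>f y - f z\<bar> \<le> L * \<bar>y - z\<bar> powr \<gamma>"
      by blast
    have "((\<lambda>y. f y - f x) \<longlongrightarrow> 0) (at x)"
    proof (rule Lim_null_comparison)
      have "((\<lambda>y. L * \<bar>y - x\<bar> powr \<gamma>) \<longlongrightarrow> L * \<bar>x - x\<bar> powr \<gamma>) (at x)"
        using \<open>\<gamma> > 0\<close> by (intro tendsto_intros tendsto_powr') auto
      then show "((\<lambda>y. L * \<bar>y - x\<bar> powr \<gamma>) \<longlongrightarrow> 0) (at x)" by simp
      have "norm (f y - f x) \<le> L * \<bar>y - x\<bar> powr \<gamma>" if "dist y x < min d 1" for y
        unfolding real_norm_def using that by (intro L) (auto simp: dist_real_def abs_real_def split: if_splits)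
      moreover have "\<forall>\<^sub>F y in at x. dist y x < min d 1"
        using d by (auto simp: eventually_at intro!: exI[of _ "min d 1"])
      ultimately show "\<forall>\<^sub>F y in at x. norm (f y - f x) \<le> L * \<bar>y - x\<bar> powr \<gamma>"
        by (auto elim: eventually_mono)
    qed
    then show ?thesis by (simp add: isCont_def LIM_zero_iff)
  qed
  then show cont: "continuous_on UNIV f" by (simp add: continuous_on_eq_continuous_at)
  show "locally_holder \<gamma> f"
    unfolding locally_holder_def
  proof (intro allI impI)
    fix R :: real assume "R > 0"
    from loc[OF \<open>R > 0\<close>] obtain d L where d: "d > 0" and L: "\<And>x y. x \<in> {-R..R} \<Longrightarrow> y \<in> {-R..R} \<Longrightarrow>
        \<bar>x - y\<bar> \<le> d \<Longrightarrow> \<bar>f x - f y\<bar> \<le> L * \<bar>x - y\<bar> powr \<gamma>"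
      by blast
    have "bounded (f ` {-R..R})"
      by (intro compact_imp_bounded compact_continuous_image continuous_on_subset[OF cont]) auto
    then obtain b where "\<forall>x\<in>{-R..R}. \<bar>f x\<bar> \<le> b" by (auto simp: bounded_iff)
    then have b: "\<And>x. x \<in> {-R..R} \<Longrightarrow> \<bar>f x\<bar> \<le> b" by blast
    then have b0: "b \<ge> 0" using \<open>R > 0\<close> by (smt (verit) atLeastAtMost_iff)
    have "\<bar>f x - f y\<bar> \<le> (\<bar>L\<bar> + 2 * b / d powr \<gamma>) * \<bar>x - y\<bar> powr \<gamma>"
      if xy: "x \<in> {-R..R}" "y \<in> {-R..R}" for x y
    proof (cases "\<bar>x - y\<bar> \<le> d")
      case True
      have "L \<le> \<bar>L\<bar> + 2 * b / d powr \<gamma>" using b0 by (smt (verit) divide_nonneg_nonneg powr_ge_zero)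
      then have "L * \<bar>x - y\<bar> powr \<gamma> \<le> (\<bar>L\<bar> + 2 * b / d powr \<gamma>) * \<bar>x - y\<bar> powr \<gamma>"
        by (intro mult_right_mono) auto
      then show ?thesis using L[OF xy True] by linarith
    next
      case False
      have "\<bar>f x - f y\<bar> \<le> 2 * b" using b[OF xy(1)] b[OF xy(2)] by linarith
      also have "\<dots> = 2 * b / d powr \<gamma> * d powr \<gamma>" using d by simp
      also have "\<dots> \<le> 2 * b / d powr \<gamma> * \<bar>x - y\<bar> powr \<gamma>"
        using False d b0 \<open>\<gamma> > 0\<close> by (intro mult_left_mono powr_mono2) auto
      also have "\<dots> \<le> (\<bar>L\<bar> + 2 * b / d powr \<gamma>) * \<bar>x - y\<bar> powr \<gamma>"
        by (intro mult_right_mono) auto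
      finally show ?thesis .
    qed
    then show "\<exists>L. \<forall>x\<in>{-R..R}. \<forall>y\<in>{-R..R}. \<bar>f x - f y\<bar> \<le> L * \<bar>x - y\<bar> powr \<gamma>" by blast
  qed
qed

definition dyadic_floor :: "nat \<Rightarrow> real \<Rightarrow> real" where
  "dyadic_floor n x = of_int \<lfloor>2 ^ n * x\<rfloor> / 2 ^ n"

lemma dyadic_floor_dist: "\<bar>dyadic_floor n x - x\<bar> \<le> 1 / 2 ^ n"
proof -
  have "\<bar>of_int \<lfloor>2 ^ n * x\<rfloor> - 2 ^ n * x\<bar> \<le> 1" by linarith
  then have "\<bar>of_int \<lfloor>2 ^ n * x\<rfloor> - 2 ^ n * x\<bar> / 2 ^ n \<le> 1 / 2 ^ n" by (intro divide_right_mono) auto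
  moreover have "dyadic_floor n x - x = (of_int \<lfloor>2 ^ n * x\<rfloor> - 2 ^ n * x) / 2 ^ n"
    by (simp add: dyadic_floor_def diff_divide_distrib)
  ultimately show ?thesis by (simp add: abs_divide)
qed

lemma dyadic_scale:
  assumes "0 < d" "d \<le> 1 / 2 ^ n0"
  obtains n where "n0 \<le> n" "1 / 2 ^ Suc n < d" "d \<le> 1 / (2::real) ^ n"
proof -
  define P where "P k \<longleftrightarrow> 1 / 2 ^ Suc (n0 + k) < d" for k
  obtain k where "(1/2) ^ k < d" using assms(1) real_arch_pow_inv[of d "1/2"] by auto
  moreover have "(1/2::real) ^ Suc (n0 + k) \<le> (1/2) ^ k" by (rule power_decreasing) auto
  ultimately have "P k" unfolding P_def by (simp add: power_one_over)
  then have *: "P (LEAST k. P k)" by (rule LeastI)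
  \<comment> \<open>If the least index is 0, the bound is the assumption on d; otherwise it is
    minimality at the preceding index.\<close>
  have "d \<le> 1 / 2 ^ (n0 + (LEAST k. P k))"
  proof (cases "LEAST k. P k")
    case (Suc j)
    then have "\<not> P j" by (intro not_less_Least) simp
    then show ?thesis using Suc by (simp add: P_def)
  qed (use assms in simp)
  then show ?thesis using * by (intro that[of "n0 + (LEAST k. P k)"]) (auto simp: P_def)
qed

text \<open>Each \<open>v x\<close> is a limit along dyadic floors with tail error q^n / (1 - q),
  where q = 2^-\<gamma>. Two points at distance about 2^-n have equal or adjacent floors at level n,
  so their values differ by O(q^n), which is O(|x - y|^\<gamma>). The index range 4^n makes the
  level-n grid cover [-2^n, 2^n], so one \<open>N\<close> serves every bounded interval.\<close>

lemma dyadic_increments_imp_holder: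
  fixes f :: "real \<Rightarrow> real"
  assumes \<gamma>: "\<gamma> > 0"
    and f: "\<And>n i. n \<ge> N \<Longrightarrow> \<bar>i\<bar> \<le> 4 ^ n \<Longrightarrow>
      \<bar>f (of_int (i + 1) / 2 ^ n) - f (of_int i / 2 ^ n)\<bar> \<le> (2 powr (-\<gamma>)) ^ n"
  defines "v \<equiv> (\<lambda>x. lim (\<lambda>n. f (dyadic_floor n x)))"
  shows "continuous_on UNIV v" and "locally_holder \<gamma> v"
proof -
  define q where "q = 2 powr (-\<gamma>)"
  have q: "0 < q" "q < 1" using \<gamma> by (auto simp: q_def powr_less_one)
  note f = f[folded q_def]
  have loc: "\<exists>d>0. \<exists>L. \<forall>x\<in>{-R..R}. \<forall>y\<in>{-R..R}. \<bar>x - y\<bar> \<le> d \<longrightarrow> \<bar>v x - v y\<bar> \<le> L * \<bar>x - y\<bar> powr \<gamma>"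
    if "R > 0" for R
  proof -
    obtain m where m: "R + 1 < 2 ^ m" using real_arch_pow[of 2 "R + 1"] by auto
    define n0 where "n0 = max N m"
    have n0: "n \<ge> N" "R + 1 \<le> 2 ^ n" if "n \<ge> n0" for n
    proof -
      show "n \<ge> N" using that by (simp add: n0_def)
      have "(2::real) ^ m \<le> 2 ^ n" using that by (intro power_increasing) (auto simp: n0_def)
      then show "R + 1 \<le> 2 ^ n" using m by linarith
    qed
    \<comment> \<open>The second bound is for the next level: the floor there has index 2 i or 2 i +
      1, and the increment from 2 i must lie in the range of the hypothesis at level n + 1.\<close>
    have small: "\<bar>\<lfloor>2 ^ n * x\<rfloor>\<bar> \<le> 4 ^ n" "\<bar>2 * \<lfloor>2 ^ n * x\<rfloor>\<bar> \<le> 4 ^ Suc n"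
      if "n \<ge> n0" "x \<in> {-R..R}" for n x
    proof -
      have "\<bar>2 ^ n * x\<bar> \<le> 2 ^ n * R"
        using that(2) by (auto simp: abs_mult intro!: mult_left_mono)
      then have "\<bar>real_of_int \<lfloor>2 ^ n * x\<rfloor>\<bar> \<le> 2 ^ n * R + 1" by linarith
      also have "\<dots> \<le> 2 ^ n * R + 2 ^ n" by simp
      also have "\<dots> = 2 ^ n * (R + 1)" by (simp add: algebra_simps)
      also have "\<dots> \<le> 2 ^ n * 2 ^ n" using n0[OF that(1)] by (intro mult_left_mono) auto
      also have "\<dots> = of_int (4 ^ n)" by (simp flip: power_mult_distrib)
      finally show "\<bar>\<lfloor>2 ^ n * x\<rfloor>\<bar> \<le> 4 ^ n" by linarith
      then show "\<bar>2 * \<lfloor>2 ^ n * x\<rfloor>\<bar> \<le> 4 ^ Suc n" by simp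
    qed
    have incr: "\<bar>f (dyadic_floor (Suc n) x) - f (dyadic_floor n x)\<bar> \<le> q ^ Suc n"
      if "n \<ge> n0" "x \<in> {-R..R}" for n x
    proof -
      let ?i = "\<lfloor>2 ^ n * x\<rfloor>"
      have eq: "dyadic_floor n x = of_int (2 * ?i) / 2 ^ Suc n" by (simp add: dyadic_floor_def)
      have "\<lfloor>2 ^ Suc n * x\<rfloor> = 2 * ?i \<or> \<lfloor>2 ^ Suc n * x\<rfloor> = 2 * ?i + 1"
      proof -
        have "2 ^ Suc n * x = 2 * (2 ^ n * x)" by simp
        then show ?thesis by linarith
      qed
      then show ?thesis
      proof
        assume "\<lfloor>2 ^ Suc n * x\<rfloor> = 2 * ?i"
        then have "dyadic_floor (Suc n) x = dyadic_floor n x"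
          unfolding eq by (simp add: dyadic_floor_def)
        then show ?thesis using q by simp
      next
        assume "\<lfloor>2 ^ Suc n * x\<rfloor> = 2 * ?i + 1"
        then have "dyadic_floor (Suc n) x = of_int (2 * ?i + 1) / 2 ^ Suc n"
          by (simp only: dyadic_floor_def)
        then show ?thesis
          unfolding eq using f[of "Suc n" "2 * ?i"] small(2)[OF that] n0(1)[OF that(1)] by simp
      qed
    qed
    have app: "\<bar>v x - f (dyadic_floor n x)\<bar> \<le> q ^ n / (1 - q)" if "n \<ge> n0" "x \<in> {-R..R}" for n x
      unfolding v_def by (rule geometric_increments_limit(2)[OF q incr]) (use that in auto)
    have scale: "\<bar>v x - v y\<bar> \<le> (1 + 2 / (1 - q)) * q ^ n"
      if "n \<ge> n0" "x \<in> {-R..R}" "y \<in> {-R..R}" "x \<le> y" "y - x \<le> 1 / 2 ^ n" for n x y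
    proof -
      have "2 ^ n * y - 2 ^ n * x \<le> 1" "2 ^ n * x \<le> 2 ^ n * y"
        using mult_left_mono[OF that(5), of "2 ^ n"] that(4) by (simp_all add: algebra_simps)
      then have "\<lfloor>2 ^ n * y\<rfloor> = \<lfloor>2 ^ n * x\<rfloor> \<or> \<lfloor>2 ^ n * y\<rfloor> = \<lfloor>2 ^ n * x\<rfloor> + 1" by linarith
      then have "\<bar>f (dyadic_floor n y) - f (dyadic_floor n x)\<bar> \<le> q ^ n"
      proof
        assume "\<lfloor>2 ^ n * y\<rfloor> = \<lfloor>2 ^ n * x\<rfloor>"
        then show ?thesis using q by (simp add: dyadic_floor_def)
      next
        assume "\<lfloor>2 ^ n * y\<rfloor> = \<lfloor>2 ^ n * x\<rfloor> + 1"
        then show ?thesis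
          using f[OF n0(1)[OF that(1)] small(1)[OF that(1,2)]] by (simp add: dyadic_floor_def)
      qed
      then have "\<bar>v x - v y\<bar> \<le> q ^ n + 2 * (q ^ n / (1 - q))"
        using app[OF that(1,2)] app[OF that(1,3)] by linarith
      then show ?thesis by (simp add: algebra_simps)
    qed
    have "\<bar>v x - v y\<bar> \<le> ((1 + 2 / (1 - q)) * 2 powr \<gamma>) * \<bar>x - y\<bar> powr \<gamma>"
      if xy: "x \<in> {-R..R}" "y \<in> {-R..R}" and d: "\<bar>x - y\<bar> \<le> 1 / 2 ^ n0" for x y
    proof (cases "x = y")
      case False
      obtain n where n: "n0 \<le> n" "1 / 2 ^ Suc n < \<bar>x - y\<bar>" "\<bar>x - y\<bar> \<le> 1 / 2 ^ n"
        using dyadic_scale[of "\<bar>x - y\<bar>" n0] False d by auto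
      have "\<bar>v x - v y\<bar> \<le> (1 + 2 / (1 - q)) * q ^ n"
        using scale[OF n(1), of x y] scale[OF n(1), of y x] xy n(3)
        by (cases "x \<le> y") (auto simp: abs_minus_commute)
      also have "q ^ n = (1 / 2 ^ n) powr \<gamma>"
        by (simp add: q_def powr_minus powr_divide power_divide powr_powr powr_realpow[symmetric]
              inverse_eq_divide mult.commute)
      also have "\<dots> \<le> (2 * \<bar>x - y\<bar>) powr \<gamma>" using n(2) \<gamma> by (intro powr_mono2) auto
      also have "\<dots> = 2 powr \<gamma> * \<bar>x - y\<bar> powr \<gamma>" by (simp add: powr_mult)
      finally show ?thesis using q by (simp add: mult_left_mono mult.assoc)
    qed simp
    then show ?thesis by (intro exI[of _ "1 / 2 ^ n0"] conjI exI[of _ "(1 + 2 / (1 - q)) * 2 powr \<gamma>"]) auto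
  qed
  show "continuous_on UNIV v" and "locally_holder \<gamma> v"
    using locally_holder_imp_continuous[OF \<gamma> loc] by blast+
qed

text \<open>Markov's inequality for |Z|^p.\<close>

lemma (in prob_space) moment_tail_bound:
  assumes [measurable]: "Z \<in> borel_measurable M"
    and "(\<integral>\<^sup>+ \<omega>. ennreal (\<bar>Z \<omega>\<bar> ^ p) \<partial>M) \<le> ennreal c" and e: "e > 0" and c: "c \<ge> 0"
  shows "prob {\<omega> \<in> space M. \<bar>Z \<omega>\<bar> > e} \<le> c / e ^ p"
proof -
  have "emeasure M {\<omega> \<in> space M. \<bar>Z \<omega>\<bar> > e} = (\<integral>\<^sup>+ \<omega>. indicator {\<omega> \<in> space M. \<bar>Z \<omega>\<bar> > e} \<omega> \<partial>M)"
    by simp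
  also have "\<dots> \<le> (\<integral>\<^sup>+ \<omega>. ennreal (1 / e ^ p) * ennreal (\<bar>Z \<omega>\<bar> ^ p) \<partial>M)"
  proof (intro nn_integral_mono)
    fix \<omega>
    show "indicator {\<omega> \<in> space M. \<bar>Z \<omega>\<bar> > e} \<omega> \<le> ennreal (1 / e ^ p) * ennreal (\<bar>Z \<omega>\<bar> ^ p)"
    proof (cases "\<bar>Z \<omega>\<bar> > e")
      case True
      have "e ^ p \<le> \<bar>Z \<omega>\<bar> ^ p" using True e by (intro power_mono) auto
      then have "1 \<le> \<bar>Z \<omega>\<bar> ^ p / e ^ p" using e by simp
      then show ?thesis using e by (auto simp: indicator_def simp flip: ennreal_mult)
    qed simp
  qed
  also have "\<dots> = ennreal (1 / e ^ p) * (\<integral>\<^sup>+ \<omega>. ennreal (\<bar>Z \<omega>\<bar> ^ p) \<partial>M)"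
    by (intro nn_integral_cmult) measurable
  also have "\<dots> \<le> ennreal (1 / e ^ p) * ennreal c" by (intro mult_left_mono assms) auto
  also have "\<dots> = ennreal (c / e ^ p)" using e c by (simp flip: ennreal_mult)
  finally show ?thesis using e c by (simp add: emeasure_eq_measure ennreal_le_iff)
qed

text \<open>The modification is the limit of X along the dyadic floors of x, so it is measurable at every x
  without a completeness assumption on M. The grid used at level n covers [-2^n, 2^n], so a single
  Borel-Cantelli argument handles all bounded intervals at once.\<close>
theorem (in prob_space) kolmogorov_chentsov:
  fixes X :: "real \<Rightarrow> 'a \<Rightarrow> real" and p :: nat
  assumes [measurable]: "\<And>x. X x \<in> borel_measurable M"
    and \<gamma>: "\<gamma> > 0" and r: "r \<ge> real p * \<gamma> + 3" and K: "K \<ge> 0"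
    and moment: "\<And>x y. (\<integral>\<^sup>+ \<omega>. ennreal (\<bar>X x \<omega> - X y \<omega>\<bar> ^ p) \<partial>M) \<le> ennreal (K * \<bar>x - y\<bar> powr r)"
  shows "holder_modification M \<gamma> X"
proof -
  define q where "q = 2 powr (-\<gamma>)"
  have q: "0 < q" "q < 1" using \<gamma> by (auto simp: q_def powr_less_one)
  \<comment> \<open>With threshold q^n = 2^(-n \<gamma>) the moment bound yields K 2^(n p \<gamma> -
    n r), and r exceeds p \<gamma> by at least 3. The rate 8^-n beats the number of grid intervals
    at level n, which is of order 4^n.\<close>
  have tail: "prob {\<omega> \<in> space M. \<bar>X x \<omega> - X y \<omega>\<bar> > q ^ n} \<le> K * (1/8) ^ n"
    if "\<bar>x - y\<bar> \<le> 1 / 2 ^ n" for x y n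
  proof -
    have "prob {\<omega> \<in> space M. \<bar>X x \<omega> - X y \<omega>\<bar> > q ^ n} \<le> K * \<bar>x - y\<bar> powr r / (q ^ n) ^ p"
      using q K moment by (intro moment_tail_bound) auto
    also have "\<dots> \<le> K * (1 / 2 ^ n) powr r / (q ^ n) ^ p"
      using that q K r \<gamma> by (intro divide_right_mono mult_left_mono powr_mono2) (auto intro: order_trans[rotated])
    also have "\<dots> = K * 2 powr (- real n * r + real n * real p * \<gamma>)"
    proof -
      have "(1 / 2 ^ n) powr r = 2 powr (- real n * r)"
        by (simp add: powr_divide powr_minus powr_powr powr_realpow[symmetric] inverse_eq_divide)
      moreover have "(q ^ n) ^ p = 2 powr (- (real n * real p * \<gamma>))"
        by (simp add: q_def powr_powr powr_realpow[symmetric] algebra_simps)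
      ultimately show ?thesis
        by (simp only: powr_add powr_minus) (simp add: divide_inverse)
    qed
    also have "\<dots> \<le> K * 2 powr (- 3 * real n)"
    proof -
      have "real n * (real p * \<gamma> + 3) \<le> real n * r" using r by (intro mult_left_mono) auto
      then have "- real n * r + real n * real p * \<gamma> \<le> - 3 * real n" by (simp add: algebra_simps)
      then show ?thesis using K by (intro mult_left_mono powr_mono) auto
    qed
    also have "2 powr (- 3 * real n) = (1/8) ^ n"
    proof -
      have "2 powr (- 3 * real n) = (2 powr (-3)) powr real n" by (simp add: powr_powr)
      also have "2 powr (-3::real) = 1/8" by (simp add: powr_minus)
      finally show ?thesis by (simp add: powr_realpow)
    qed
    finally show ?thesis .
  qed
  define V where "V x \<omega> = lim (\<lambda>n. X (dyadic_floor n x) \<omega>)" for x \<omega>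
  have [measurable]: "V x \<in> borel_measurable M" for x
    unfolding V_def by measurable
  have modif: "AE \<omega> in M. V x \<omega> = X x \<omega>" for x
  proof -
    let ?A = "\<lambda>n. {\<omega> \<in> space M. \<bar>X (dyadic_floor n x) \<omega> - X x \<omega>\<bar> > q ^ n}"
    \<comment> \<open>For a fixed x there is one event per level, so the summable tail shows that
      \<open>X\<close> along the floors of x converges almost surely to \<open>X x\<close>
      itself.\<close>
    have "AE \<omega> in M. \<forall>\<^sub>F n in sequentially. \<omega> \<in> space M - ?A n"
    proof (rule borel_cantelli_AE1)
      show "summable (\<lambda>n. prob (?A n))"
      proof (rule summable_comparison_test')
        show "summable (\<lambda>n. K * (1/8) ^ n)" by (intro summable_mult summable_geometric) auto
        show "norm (prob (?A n)) \<le> K * (1/8) ^ n" for n using tail[OF dyadic_floor_dist] by simp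
      qed
    qed (auto simp: less_top[symmetric])
    then show ?thesis
    proof eventually_elim
      case (elim \<omega>)
      have "(\<lambda>n. X (dyadic_floor n x) \<omega> - X x \<omega>) \<longlonglongrightarrow> 0"
      proof (rule Lim_null_comparison)
        show "\<forall>\<^sub>F n in sequentially. norm (X (dyadic_floor n x) \<omega> - X x \<omega>) \<le> q ^ n"
          using elim by eventually_elim auto
        show "(\<lambda>n. q ^ n) \<longlonglongrightarrow> 0" using q by (intro LIMSEQ_realpow_zero) auto
      qed
      then have "(\<lambda>n. X (dyadic_floor n x) \<omega>) \<longlonglongrightarrow> X x \<omega>" by (simp add: LIM_zero_iff)
      then show ?case unfolding V_def by (rule limI)
    qed
  qed
  have paths: "AE \<omega> in M. continuous_on UNIV (\<lambda>x. V x \<omega>) \<and> locally_holder \<gamma> (\<lambda>x. V x \<omega>)"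
  proof -
    let ?B = "\<lambda>n i. {\<omega> \<in> space M. \<bar>X (of_int (i + 1) / 2 ^ n) \<omega> - X (of_int i / 2 ^ n) \<omega>\<bar> > q ^ n}"
    let ?A = "\<lambda>n. \<Union>i\<in>{- (4 ^ n)..4 ^ n::int}. ?B n i"
    have "AE \<omega> in M. \<forall>\<^sub>F n in sequentially. \<omega> \<in> space M - ?A n"
    proof (rule borel_cantelli_AE1)
      show "summable (\<lambda>n. prob (?A n))"
      proof (rule summable_comparison_test')
        show "summable (\<lambda>n. 3 * K * (1/2) ^ n)" by (intro summable_mult summable_geometric) auto
        fix n :: nat assume "n \<ge> 0"
        have "prob (?A n) \<le> (\<Sum>i\<in>{- (4 ^ n)..4 ^ n::int}. prob (?B n i))"
          by (intro finite_measure_subadditive_finite) auto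
        also have "\<dots> \<le> (\<Sum>i\<in>{- (4 ^ n)..4 ^ n::int}. K * (1/8) ^ n)"
        proof (intro sum_mono tail)
          show "\<bar>of_int (i + 1) / 2 ^ n - of_int i / 2 ^ n\<bar> \<le> 1 / (2::real) ^ n" for i :: int
            by (simp flip: diff_divide_distrib)
        qed
        also have "\<dots> = (2 * 4 ^ n + 1) * (K * (1/8) ^ n)"
          by (simp add: nat_add_distrib nat_mult_distrib nat_power_eq)
        also have "\<dots> \<le> (3 * 4 ^ n) * (K * (1/8) ^ n)"
          using K by (intro mult_right_mono) auto
        also have "\<dots> = 3 * K * ((4 * (1/8)) ^ n)" by (simp only: power_mult_distrib) simp
        finally show "norm (prob (?A n)) \<le> 3 * K * (1/2) ^ n" by simp
      qed
    qed (auto simp: less_top[symmetric])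
    then show ?thesis
    proof eventually_elim
      case (elim \<omega>)
      then obtain N where N: "\<And>n. n \<ge> N \<Longrightarrow> \<omega> \<in> space M - ?A n" by (auto simp: eventually_sequentially)
      have "\<bar>X (of_int (i + 1) / 2 ^ n) \<omega> - X (of_int i / 2 ^ n) \<omega>\<bar> \<le> (2 powr (-\<gamma>)) ^ n"
        if "n \<ge> N" "\<bar>i\<bar> \<le> 4 ^ n" for n i
        using N[OF that(1)] that(2) unfolding q_def[symmetric] by (auto simp: abs_le_iff not_less)
      from dyadic_increments_imp_holder[OF \<gamma> this] show ?case unfolding V_def by simp
    qed
  qed
  show ?thesis
    unfolding holder_modification_def using modif paths by (intro exI[of _ V]) auto
qed

section \<open>White-noise integrals\<close>

lemma cmod_diff_square_le: "(cmod (a - b))\<^sup>2 \<le> 2 * (cmod a)\<^sup>2 + 2 * (cmod b)\<^sup>2"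
proof -
  have "(cmod (a - b))\<^sup>2 \<le> (cmod a + cmod b)\<^sup>2"
    by (intro power_mono norm_triangle_ineq4) auto
  also have "\<dots> \<le> 2 * (cmod a)\<^sup>2 + 2 * (cmod b)\<^sup>2"
    using sum_squares_bound[of "cmod a" "cmod b"] by (simp add: power2_sum)
  finally show ?thesis .
qed

lemma nn_integral_cmod_diff_square_le:
  assumes [measurable]: "f \<in> borel_measurable M" "g \<in> borel_measurable M"
  shows "(\<integral>\<^sup>+ x. ennreal ((cmod (f x - g x))\<^sup>2) \<partial>M) \<le>
    2 * (\<integral>\<^sup>+ x. ennreal ((cmod (f x))\<^sup>2) \<partial>M) + 2 * (\<integral>\<^sup>+ x. ennreal ((cmod (g x))\<^sup>2) \<partial>M)"
proof -
  have "(\<integral>\<^sup>+ x. ennreal ((cmod (f x - g x))\<^sup>2) \<partial>M) \<le>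
      (\<integral>\<^sup>+ x. 2 * ennreal ((cmod (f x))\<^sup>2) + 2 * ennreal ((cmod (g x))\<^sup>2) \<partial>M)"
  proof (intro nn_integral_mono)
    fix x
    have "ennreal ((cmod (f x - g x))\<^sup>2) \<le> ennreal (2 * (cmod (f x))\<^sup>2 + 2 * (cmod (g x))\<^sup>2)"
      by (intro ennreal_leI cmod_diff_square_le)
    then show "ennreal ((cmod (f x - g x))\<^sup>2) \<le> 2 * ennreal ((cmod (f x))\<^sup>2) + 2 * ennreal ((cmod (g x))\<^sup>2)"
      by (simp add: ennreal_plus ennreal_mult)
  qed
  also have "\<dots> = 2 * (\<integral>\<^sup>+ x. ennreal ((cmod (f x))\<^sup>2) \<partial>M) + 2 * (\<integral>\<^sup>+ x. ennreal ((cmod (g x))\<^sup>2) \<partial>M)"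
    by (simp add: nn_integral_add nn_integral_cmult)
  finally show ?thesis .
qed

text \<open>The truncated transforms of a real function are Hermitian at every frequency. Reflection
  preserves Lebesgue measure and conjugation preserves the modulus, so both sides are L2 limits of
  the same functions and agree almost everywhere.\<close>

lemma fourier_L2_hermitian:
  assumes f: "f \<in> borel_measurable lborel" and F: "fourier_L2 f F"
  shows "AE l in lborel. F (- l) = cnj (F l)"
proof -
  define T where "T R l = (LINT x:{-R..R}|lborel. exp (- (\<i> * complex_of_real (l * x))) * complex_of_real (f x))"
    for R l
  define D where "D R = (\<integral>\<^sup>+ l. ennreal ((cmod (F l - T R l))\<^sup>2) \<partial>lborel)" for R
  have [measurable]: "F \<in> borel_measurable borel" "f \<in> borel_measurable borel"
    using F f by (auto simp: fourier_L2_def)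
  have [measurable]: "T R \<in> borel_measurable borel" for R
    unfolding T_def set_lebesgue_integral_def by measurable
  have [measurable]: "cnj \<in> borel_measurable borel"
    by (intro borel_measurable_continuous_onI continuous_intros)
  have D: "(D \<longlongrightarrow> 0) at_top"
    using F unfolding fourier_L2_def D_def[abs_def] T_def by blast
  have T_cnj: "T R (- l) = cnj (T R l)" for R l
    unfolding T_def set_lebesgue_integral_def
    by (subst Bochner_Integration.integral_cnj[symmetric]) (simp add: exp_cnj scaleR_conv_of_real)
  let ?J = "\<integral>\<^sup>+ l. ennreal ((cmod (F (- l) - cnj (F l)))\<^sup>2) \<partial>lborel"
  have "?J \<le> 2 * D R + 2 * D R" for R
  proof -
    have "?J = (\<integral>\<^sup>+ l. ennreal ((cmod ((F (- l) - T R (- l)) - cnj (F l - T R l)))\<^sup>2) \<partial>lborel)"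
      by (simp add: T_cnj)
    also have "\<dots> \<le> 2 * (\<integral>\<^sup>+ l. ennreal ((cmod (F (- l) - T R (- l)))\<^sup>2) \<partial>lborel) +
        2 * (\<integral>\<^sup>+ l. ennreal ((cmod (cnj (F l - T R l)))\<^sup>2) \<partial>lborel)"
      by (intro nn_integral_cmod_diff_square_le) measurable
    also have "(\<integral>\<^sup>+ l. ennreal ((cmod (F (- l) - T R (- l)))\<^sup>2) \<partial>lborel) = D R"
      unfolding D_def by (subst nn_integral_real_affine[of _ "-1" 0]) auto
    also have "(\<integral>\<^sup>+ l. ennreal ((cmod (cnj (F l - T R l)))\<^sup>2) \<partial>lborel) = D R"
      unfolding D_def complex_mod_cnj ..
    finally show ?thesis .
  qed
  moreover have "((\<lambda>R. 2 * D R + 2 * D R) \<longlongrightarrow> 2 * 0 + 2 * 0) at_top"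
    by (intro tendsto_add ennreal_tendsto_cmult D) auto
  ultimately have "?J \<le> 0"
    by (intro tendsto_lowerbound[where F = at_top]) (auto simp: trivial_limit_at_top_linorder)
  then have "?J = 0" by simp
  then show ?thesis
    by (subst (asm) nn_integral_0_iff_AE) (auto elim: eventually_mono)
qed

lemma L2herm_diff:
  assumes "L2herm f" "L2herm g"
  shows "L2herm (\<lambda>l. f l - g l)"
proof -
  have [measurable]: "f \<in> borel_measurable lborel" "g \<in> borel_measurable lborel"
    using assms by (auto simp: L2herm_def sq_int_def)
  have "2 * (\<integral>\<^sup>+ x. ennreal ((cmod (f x))\<^sup>2) \<partial>lborel) + 2 * (\<integral>\<^sup>+ x. ennreal ((cmod (g x))\<^sup>2) \<partial>lborel) < \<infinity>"
    using assms by (auto simp: L2herm_def sq_int_def ennreal_mult_less_top)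
  then have "sq_int (\<lambda>l. f l - g l)"
    unfolding sq_int_def using nn_integral_cmod_diff_square_le[of f lborel g] by (auto intro: le_less_trans)
  moreover have "AE l in lborel. f (- l) - g (- l) = cnj (f l - g l)"
    using assms unfolding L2herm_def by auto
  ultimately show ?thesis by (simp add: L2herm_def)
qed

text \<open>The constant is (2k - 1)!!; the form isolates the k-th power of the variance, through
  which the moment is later estimated.\<close>

lemma normal_even_moment_nn_integral:
  assumes Z: "distributed M lborel Z (normal_density 0 \<sigma>)" and \<sigma>: "\<sigma> > 0"
  shows "(\<integral>\<^sup>+ \<omega>. ennreal (\<bar>Z \<omega>\<bar> ^ (2 * k)) \<partial>M) = ennreal (fact (2 * k) / (2 ^ k * fact k) * (\<sigma>\<^sup>2) ^ k)"
proof -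
  have "(\<integral>\<^sup>+ \<omega>. ennreal (\<bar>Z \<omega>\<bar> ^ (2 * k)) \<partial>M) =
      (\<integral>\<^sup>+ x. ennreal (normal_density 0 \<sigma> x) * ennreal (\<bar>x\<bar> ^ (2 * k)) \<partial>lborel)"
    by (rule distributed_nn_integral[OF Z, symmetric]) auto
  also have "\<dots> = (\<integral>\<^sup>+ x. ennreal (normal_density 0 \<sigma> x * (x - 0) ^ (2 * k)) \<partial>lborel)"
    by (intro nn_integral_cong) (simp add: ennreal_mult' power_even_abs)
  also have "\<dots> = ennreal (fact (2 * k) / ((2 / \<sigma>\<^sup>2) ^ k * fact k))"
    using normal_moment_even[OF \<sigma>, of 0 k]
    by (subst nn_integral_eq_integral) (auto simp: has_bochner_integral_iff)
  also have "fact (2 * k) / ((2 / \<sigma>\<^sup>2) ^ k * fact k) = fact (2 * k) / (2 ^ k * fact k) * (\<sigma>\<^sup>2) ^ k"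
    by (simp add: power_divide)
  finally show ?thesis .
qed

lemma white_noise_even_moment:
  assumes W: "white_noise_integral M I" and f: "L2herm f" and "k > 0" "b \<ge> 0"
    and b: "(\<integral>\<^sup>+ l. ennreal ((cmod (f l))\<^sup>2) \<partial>lborel) \<le> ennreal b"
  shows "(\<integral>\<^sup>+ \<omega>. ennreal (\<bar>I f \<omega>\<bar> ^ (2 * k)) \<partial>M) \<le> ennreal (fact (2 * k) / (2 ^ k * fact k) * b ^ k)"
proof -
  define v where "v = (LINT l|lborel. (cmod (f l))\<^sup>2)"
  have [measurable]: "f \<in> borel_measurable lborel"
    using f by (auto simp: L2herm_def sq_int_def)
  have "integrable lborel (\<lambda>l. (cmod (f l))\<^sup>2)"
    using f by (intro integrableI_nonneg) (auto simp: L2herm_def sq_int_def)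
  then have "ennreal v \<le> ennreal b"
    using b unfolding v_def by (subst nn_integral_eq_integral[symmetric]) auto
  then have vb: "v \<le> b" using \<open>b \<ge> 0\<close> by (simp add: ennreal_le_iff)
  have v0: "v \<ge> 0" unfolding v_def by (intro Bochner_Integration.integral_nonneg) auto
  show ?thesis
  \<comment> \<open>A degenerate integral has no normal density and is treated apart; there k > 0
    makes the moment zero.\<close>
  proof (cases "v = 0")
    case True
    then have "AE \<omega> in M. I f \<omega> = 0"
      using W f unfolding white_noise_integral_def by (auto simp: Let_def v_def)
    then have "(\<integral>\<^sup>+ \<omega>. ennreal (\<bar>I f \<omega>\<bar> ^ (2 * k)) \<partial>M) = (\<integral>\<^sup>+ \<omega>. 0 \<partial>M)"
      using \<open>k > 0\<close> by (intro nn_integral_cong_AE) (auto elim: eventually_mono)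
    then show ?thesis by simp
  next
    case False
    then have "distributed M lborel (I f) (normal_density 0 (sqrt v))"
      using W f unfolding white_noise_integral_def by (auto simp: Let_def v_def)
    then have "(\<integral>\<^sup>+ \<omega>. ennreal (\<bar>I f \<omega>\<bar> ^ (2 * k)) \<partial>M) =
        ennreal (fact (2 * k) / (2 ^ k * fact k) * ((sqrt v)\<^sup>2) ^ k)"
      using False v0 by (intro normal_even_moment_nn_integral) auto
    also have "\<dots> \<le> ennreal (fact (2 * k) / (2 ^ k * fact k) * b ^ k)"
      using v0 vb by (intro ennreal_leI mult_left_mono power_mono) auto
    finally show ?thesis .
  qed
qed

text \<open>Increments are Gaussian, so the variance bound controls all even moments: the moment of
  order 2k is O(|x - y|^(2 k \<theta>)). The Kolmogorov criterion loses 3 / (2k) in the exponent,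
  arbitrarily little for large k, which gives every \<gamma> < \<theta>.\<close>

theorem white_noise_field_holder:
  assumes W: "white_noise_integral M I" and h: "\<And>x. L2herm (h x)" and "B \<ge> 0"
    and incr: "\<And>x y. (\<integral>\<^sup>+ l. ennreal ((cmod (h x l - h y l))\<^sup>2) \<partial>lborel) \<le> ennreal (B * \<bar>x - y\<bar> powr (2 * \<theta>))"
    and \<gamma>: "0 < \<gamma>" "\<gamma> < \<theta>"
  shows "ms_holder M \<gamma> (\<lambda>x \<omega>. c * I (h x) \<omega>)" and "holder_modification M \<gamma> (\<lambda>x \<omega>. c * I (h x) \<omega>)"
proof -
  interpret prob_space M using W by (simp add: white_noise_integral_def)
  let ?X = "\<lambda>x \<omega>. c * I (h x) \<omega>"
  have [measurable]: "I f \<in> borel_measurable M" if "L2herm f" for f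
    using W that by (simp add: white_noise_integral_def)
  define K where "K k = c ^ (2 * k) * (fact (2 * k) / (2 ^ k * fact k) * B ^ k)" for k
  have K: "K k \<ge> 0" for k using \<open>B \<ge> 0\<close> by (simp add: K_def)
  have moment: "(\<integral>\<^sup>+ \<omega>. ennreal (\<bar>?X x \<omega> - ?X y \<omega>\<bar> ^ (2 * k)) \<partial>M) \<le> ennreal (K k * \<bar>x - y\<bar> powr (2 * real k * \<theta>))"
    if "k > 0" for k x y
  proof -
    let ?f = "\<lambda>l. h x l - h y l"
    have f: "L2herm ?f" by (intro L2herm_diff h)
    \<comment> \<open>Linearity of \<open>I\<close> holds almost surely and in the form f + c g, so
      the difference is the case c = -1.\<close>
    have "AE \<omega> in M. I (\<lambda>l. h x l + complex_of_real (-1) * h y l) \<omega> = I (h x) \<omega> + (-1) * I (h y) \<omega>"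
      using W h unfolding white_noise_integral_def by blast
    then have "AE \<omega> in M. I ?f \<omega> = I (h x) \<omega> - I (h y) \<omega>" by simp
    then have "AE \<omega> in M. ?X x \<omega> - ?X y \<omega> = c * I ?f \<omega>"
      by eventually_elim (simp add: right_diff_distrib)
    then have "(\<integral>\<^sup>+ \<omega>. ennreal (\<bar>?X x \<omega> - ?X y \<omega>\<bar> ^ (2 * k)) \<partial>M) =
        (\<integral>\<^sup>+ \<omega>. ennreal (c ^ (2 * k)) * ennreal (\<bar>I ?f \<omega>\<bar> ^ (2 * k)) \<partial>M)"
    proof (intro nn_integral_cong_AE, eventually_elim)
      case (elim \<omega>)
      then show ?case by (simp add: abs_mult power_mult_distrib power_even_abs ennreal_mult)
    qed
    also have "\<dots> = ennreal (c ^ (2 * k)) * (\<integral>\<^sup>+ \<omega>. ennreal (\<bar>I ?f \<omega>\<bar> ^ (2 * k)) \<partial>M)"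
      using f by (intro nn_integral_cmult) measurable
    also have "\<dots> \<le> ennreal (c ^ (2 * k)) *
        ennreal (fact (2 * k) / (2 ^ k * fact k) * (B * \<bar>x - y\<bar> powr (2 * \<theta>)) ^ k)"
      using that incr \<open>B \<ge> 0\<close> by (intro mult_left_mono white_noise_even_moment[OF W f]) auto
    also have "\<dots> = ennreal (K k * \<bar>x - y\<bar> powr (2 * real k * \<theta>))"
    proof -
      have "(\<bar>x - y\<bar> powr (2 * \<theta>)) ^ k = \<bar>x - y\<bar> powr (2 * real k * \<theta>)"
        using that by (cases "x = y") (simp_all add: powr_power mult.left_commute mult.assoc)
      then show ?thesis
        unfolding K_def using \<open>B \<ge> 0\<close>
        by (subst ennreal_mult[symmetric]) (simp_all add: power_mult_distrib mult.assoc)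
    qed
    finally show ?thesis .
  qed
  show "ms_holder M \<gamma> ?X"
    unfolding ms_holder_def
  \<comment> \<open>The second moment is the case k = 1; at distances at most 1 the exponent 2
    \<theta> may be lowered to 2 \<gamma>.\<close>
  proof (intro exI[of _ "K 1"] allI impI)
    fix x y :: real assume "\<bar>x - y\<bar> \<le> 1"
    have "(\<integral>\<^sup>+ \<omega>. ennreal ((?X x \<omega> - ?X y \<omega>)\<^sup>2) \<partial>M) \<le> ennreal (K 1 * \<bar>x - y\<bar> powr (2 * \<theta>))"
      using moment[of 1 x y] by simp
    also have "\<dots> \<le> ennreal (K 1 * \<bar>x - y\<bar> powr (2 * \<gamma>))"
      using \<open>\<bar>x - y\<bar> \<le> 1\<close> \<gamma> K by (intro ennreal_leI mult_left_mono powr_mono') auto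
    finally show "(\<integral>\<^sup>+ \<omega>. ennreal ((?X x \<omega> - ?X y \<omega>)\<^sup>2) \<partial>M) \<le> ennreal (K 1 * \<bar>x - y\<bar> powr (2 * \<gamma>))" .
  qed
  show "holder_modification M \<gamma> ?X"
  proof -
    \<comment> \<open>The criterion's condition 2 k \<theta> \<ge> 2 k \<gamma> + 3, solved for
      k.\<close>
    obtain k :: nat where "real k > 3 / (2 * (\<theta> - \<gamma>))" using reals_Archimedean2 by blast
    moreover have "3 / (2 * (\<theta> - \<gamma>)) > 0" using \<gamma> by simp
    ultimately have "real k > 0" by linarith
    then have "k > 0" by simp
    have k: "3 < real k * (2 * (\<theta> - \<gamma>))"
      using \<open>real k > 3 / (2 * (\<theta> - \<gamma>))\<close> \<gamma> by (subst (asm) pos_divide_less_eq) auto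
    show ?thesis
    proof (rule kolmogorov_chentsov[where p = "2 * k" and r = "2 * real k * \<theta>" and K = "K k"])
      show "real (2 * k) * \<gamma> + 3 \<le> 2 * real k * \<theta>" using k by (simp add: algebra_simps)
    qed (use moment[OF \<open>k > 0\<close>] K \<gamma> h in auto)
  qed
qed

section \<open>Mittag-Leffler fields\<close>

text \<open>Up to a constant, 1 + b |l|^\<alpha> dominates (1 + l^2)^(\<alpha>/2); inserting this
  into the decay bound and squaring gives the weight of order -\<alpha>.\<close>

lemma mittag_leffler_sobolev_multiplier:
  assumes \<alpha>: "\<alpha> \<ge> 0" and a: "a > 0" and \<beta>: "0 < \<beta>" "\<beta> \<le> 1"
  obtains D where "D \<ge> 0" "\<And>l. (mittag_leffler \<beta> (- a * \<bar>l\<bar> powr \<alpha>))\<^sup>2 \<le> D * (1 + l\<^sup>2) powr (-\<alpha>)"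
proof -
  define b where "b = a / Gamma (1 + \<beta>)"
  have "Gamma (1 + \<beta>) > 0" using \<beta> by (intro Gamma_real_pos) simp
  then have b: "b > 0" using a by (simp add: b_def)
  \<comment> \<open>The factor 2^(\<alpha>/2) comes from 1 + l^2 \<le> 2 max(1, l^2), and 1 + 1/b
    from 1 + x \<le> (1 + 1/b) (1 + b x) for x \<ge> 0.\<close>
  define c where "c = 2 powr (\<alpha> / 2) * (1 + 1 / b)"
  have c: "c > 0" using b by (simp add: c_def add_pos_pos)
  have "(mittag_leffler \<beta> (- a * \<bar>l\<bar> powr \<alpha>))\<^sup>2 \<le> c\<^sup>2 * (1 + l\<^sup>2) powr (-\<alpha>)" for l
  proof -
    let ?E = "mittag_leffler \<beta> (- (a * \<bar>l\<bar> powr \<alpha>))"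
    have pos: "1 + b * \<bar>l\<bar> powr \<alpha> > 0" using b by (intro add_pos_nonneg) auto
    have E: "0 \<le> ?E" "?E \<le> 1 / (1 + b * \<bar>l\<bar> powr \<alpha>)"
      using mittag_leffler_bounds[OF \<beta>, of "a * \<bar>l\<bar> powr \<alpha>"] a by (simp_all add: b_def)
    have "(1 + l\<^sup>2) powr (\<alpha> / 2) \<le> 2 powr (\<alpha> / 2) * (1 + \<bar>l\<bar> powr \<alpha>)"
    \<comment> \<open>For |l| \<le> 1 the summand 1 alone suffices, including l = 0, where
      \<open>0 powr 0\<close> is 0; beyond 1 the summand |l|^\<alpha> suffices.\<close>
    proof (cases "\<bar>l\<bar> \<le> 1")
      case True
      then have "(1 + l\<^sup>2) powr (\<alpha> / 2) \<le> 2 powr (\<alpha> / 2)"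
        using \<alpha> by (intro powr_mono2) (auto simp: abs_square_le_1)
      also have "\<dots> \<le> 2 powr (\<alpha> / 2) * (1 + \<bar>l\<bar> powr \<alpha>)"
        by (simp add: mult_le_cancel_left1)
      finally show ?thesis .
    next
      case False
      then have "1 \<le> l\<^sup>2" using one_le_power[of "\<bar>l\<bar>" 2] by simp
      then have "(1 + l\<^sup>2) powr (\<alpha> / 2) \<le> (2 * l\<^sup>2) powr (\<alpha> / 2)"
        using \<alpha> by (intro powr_mono2) auto
      also have "\<dots> = 2 powr (\<alpha> / 2) * (\<bar>l\<bar>\<^sup>2) powr (\<alpha> / 2)" by (simp add: powr_mult)
      also have "(\<bar>l\<bar>\<^sup>2) powr (\<alpha> / 2) = (\<bar>l\<bar> powr 2) powr (\<alpha> / 2)" by simp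
      also have "\<dots> = \<bar>l\<bar> powr \<alpha>" by (simp only: powr_powr) simp
      also have "2 powr (\<alpha> / 2) * \<bar>l\<bar> powr \<alpha> \<le> 2 powr (\<alpha> / 2) * (1 + \<bar>l\<bar> powr \<alpha>)"
        by (intro mult_left_mono) auto
      finally show ?thesis .
    qed
    also have "\<dots> \<le> 2 powr (\<alpha> / 2) * ((1 + 1 / b) * (1 + b * \<bar>l\<bar> powr \<alpha>))"
    proof (intro mult_left_mono)
      have "(1 + 1 / b) * (1 + b * \<bar>l\<bar> powr \<alpha>) = 1 + \<bar>l\<bar> powr \<alpha> + (1 / b + b * \<bar>l\<bar> powr \<alpha>)"
        using b by (simp add: field_simps)
      then show "1 + \<bar>l\<bar> powr \<alpha> \<le> (1 + 1 / b) * (1 + b * \<bar>l\<bar> powr \<alpha>)"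
        using b by simp
    qed simp
    finally have "(1 + l\<^sup>2) powr (\<alpha> / 2) \<le> c * (1 + b * \<bar>l\<bar> powr \<alpha>)" by (simp add: c_def mult.assoc)
    moreover have "(1 + l\<^sup>2) powr (\<alpha> / 2) > 0"
      by (subst powr_gt_zero) (smt (verit) zero_le_power2)
    ultimately have "1 / (1 + b * \<bar>l\<bar> powr \<alpha>) \<le> c / (1 + l\<^sup>2) powr (\<alpha> / 2)"
      using pos by (simp add: pos_divide_le_eq pos_le_divide_eq mult.commute)
    with E have "?E\<^sup>2 \<le> (c / (1 + l\<^sup>2) powr (\<alpha> / 2))\<^sup>2" by (intro power_mono) auto
    also have "\<dots> = c\<^sup>2 * (1 + l\<^sup>2) powr (-\<alpha>)"
    proof -
      have "((1 + l\<^sup>2) powr (\<alpha> / 2))\<^sup>2 = (1 + l\<^sup>2) powr (\<alpha> / 2 + \<alpha> / 2)"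
        by (simp only: powr_add power2_eq_square[of "_ powr _"])
      then have "((1 + l\<^sup>2) powr (\<alpha> / 2))\<^sup>2 = (1 + l\<^sup>2) powr \<alpha>" by simp
      then show ?thesis by (simp add: power_divide powr_minus_divide)
    qed
    finally show ?thesis by simp
  qed
  then show ?thesis by (intro that[of "c\<^sup>2"]) auto
qed

lemma borel_measurable_mittag_leffler [measurable (raw)]:
  "f \<in> borel_measurable M \<Longrightarrow> (\<lambda>x. mittag_leffler \<beta> (f x)) \<in> borel_measurable M"
  unfolding mittag_leffler_def
  by (intro borel_measurable_suminf borel_measurable_divide borel_measurable_power borel_measurable_const)

text \<open>The pointwise bound exchanges the decay of the multiplier for the Sobolev weight. It
  serves both for the increments and for the square integrability of the first field.\<close>

lemma mittag_leffler_multiplier_nn_integral_le: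
  assumes "D \<ge> 0" and D: "\<And>l. (e l)\<^sup>2 \<le> D * (1 + l\<^sup>2) powr (-\<alpha>)"
    and [measurable]: "u \<in> borel_measurable lborel" "m \<in> borel_measurable lborel"
  shows "(\<integral>\<^sup>+ l. ennreal ((cmod (u l * complex_of_real (e l * m l)))\<^sup>2) \<partial>lborel) \<le>
    ennreal D * sobolev_sq (-\<alpha>) (\<lambda>l. complex_of_real (m l) * u l)"
proof -
  have "(\<integral>\<^sup>+ l. ennreal ((cmod (u l * complex_of_real (e l * m l)))\<^sup>2) \<partial>lborel) \<le>
      (\<integral>\<^sup>+ l. ennreal D * ennreal ((1 + l\<^sup>2) powr (-\<alpha>) * (cmod (complex_of_real (m l) * u l))\<^sup>2) \<partial>lborel)"
  proof (intro nn_integral_mono)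
    fix l
    have "(cmod (u l * complex_of_real (e l * m l)))\<^sup>2 = (e l)\<^sup>2 * (cmod (complex_of_real (m l) * u l))\<^sup>2"
      by (simp add: norm_mult power_mult_distrib mult_ac)
    also have "\<dots> \<le> D * (1 + l\<^sup>2) powr (-\<alpha>) * (cmod (complex_of_real (m l) * u l))\<^sup>2"
      by (intro mult_right_mono D) auto
    finally show "ennreal ((cmod (u l * complex_of_real (e l * m l)))\<^sup>2) \<le>
        ennreal D * ennreal ((1 + l\<^sup>2) powr (-\<alpha>) * (cmod (complex_of_real (m l) * u l))\<^sup>2)"
      using \<open>D \<ge> 0\<close> by (simp add: ennreal_leI mult.assoc flip: ennreal_mult)
  qed
  also have "\<dots> = ennreal D * sobolev_sq (-\<alpha>) (\<lambda>l. complex_of_real (m l) * u l)"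
    unfolding sobolev_sq_def by (intro nn_integral_cmult) measurable
  finally show ?thesis .
qed

text \<open>Common core of the two fields, which differ only in the constant \<open>c\<close> and
  the spectral factor \<open>m\<close>. Evenness of \<open>m\<close> carries the Hermitian symmetry
  of \<open>ghat\<close> over to the integrand.\<close>

theorem mlf_field_holder:
  assumes W: "white_noise_integral M I"
    and \<alpha>: "\<alpha> \<ge> 0" and \<mu>: "\<mu> > 0" and \<beta>: "0 < \<beta>" "\<beta> \<le> 1" and t: "t > 0"
    and g: "\<And>x. (\<lambda>z. g z x) \<in> borel_measurable lborel"
    and ghat: "\<And>x. fourier_L2 (\<lambda>z. g z x) (\<lambda>l. ghat l x)"
    and m [measurable]: "m \<in> borel_measurable borel" and even: "\<And>l. m (- l) = m l"
    and sq: "\<And>x. sq_int (\<lambda>l. ghat l x * complex_of_real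
          (mittag_leffler \<beta> (- \<mu> * t powr \<beta> * \<bar>l\<bar> powr \<alpha>) * m l))"
    and incr: "\<And>x y. sobolev_sq (- \<alpha>) (\<lambda>l. complex_of_real (m l) * (ghat l x - ghat l y))
        \<le> ennreal ((C * \<bar>x - y\<bar> powr \<theta>)\<^sup>2)"
    and \<gamma>: "0 < \<gamma>" "\<gamma> < \<theta>"
  shows "ms_holder M \<gamma> (mlf_field I c m ghat \<beta> \<mu> \<alpha> t) \<and>
    holder_modification M \<gamma> (mlf_field I c m ghat \<beta> \<mu> \<alpha> t)"
proof -
  let ?e = "\<lambda>l. mittag_leffler \<beta> (- \<mu> * t powr \<beta> * \<bar>l\<bar> powr \<alpha>)"
  define h where "h x l = ghat l x * complex_of_real (?e l * m l)" for x l
  have [measurable]: "(\<lambda>l. ghat l x) \<in> borel_measurable borel" for x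
    using ghat[of x] by (simp add: fourier_L2_def)
  obtain D where D: "D \<ge> 0" "\<And>l. (?e l)\<^sup>2 \<le> D * (1 + l\<^sup>2) powr (-\<alpha>)"
    using mittag_leffler_sobolev_multiplier[OF \<alpha> _ \<beta>, of "\<mu> * t powr \<beta>"] \<mu> t by auto
  have "L2herm (h x)" for x
  proof -
    have "AE l in lborel. h x (- l) = cnj (h x l)"
      using fourier_L2_hermitian[OF g[of x] ghat[of x]] by eventually_elim (simp add: h_def even)
    then show ?thesis using sq[of x] by (simp add: L2herm_def h_def[abs_def])
  qed
  moreover have "(\<integral>\<^sup>+ l. ennreal ((cmod (h x l - h y l))\<^sup>2) \<partial>lborel) \<le> ennreal (D * C\<^sup>2 * \<bar>x - y\<bar> powr (2 * \<theta>))" for x y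
  proof -
    have "(\<integral>\<^sup>+ l. ennreal ((cmod (h x l - h y l))\<^sup>2) \<partial>lborel) =
        (\<integral>\<^sup>+ l. ennreal ((cmod ((ghat l x - ghat l y) * complex_of_real (?e l * m l)))\<^sup>2) \<partial>lborel)"
      by (simp add: h_def left_diff_distrib)
    also have "\<dots> \<le> ennreal D * sobolev_sq (-\<alpha>) (\<lambda>l. complex_of_real (m l) * (ghat l x - ghat l y))"
      by (intro mittag_leffler_multiplier_nn_integral_le D) measurable
    also have "\<dots> \<le> ennreal D * ennreal ((C * \<bar>x - y\<bar> powr \<theta>)\<^sup>2)"
      by (intro mult_left_mono incr) auto
    also have "\<dots> = ennreal (D * C\<^sup>2 * \<bar>x - y\<bar> powr (2 * \<theta>))"
    proof -
      have "(\<bar>x - y\<bar> powr \<theta>)\<^sup>2 = \<bar>x - y\<bar> powr (2 * \<theta>)"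
        by (simp only: powr_add mult_2 power2_eq_square)
      then show ?thesis using D(1) by (simp add: power_mult_distrib mult.assoc flip: ennreal_mult)
    qed
    finally show ?thesis .
  qed
  ultimately show ?thesis
    using white_noise_field_holder[OF W _ _ _ \<gamma>, of h "D * C\<^sup>2" "sqrt c"] D(1)
    unfolding mlf_field_def h_def[abs_def] by auto
qed

theorem theorem4p2:
  fixes M :: "'a measure" and I :: "(real \<Rightarrow> complex) \<Rightarrow> 'a \<Rightarrow> real"
    and \<alpha> \<mu> \<beta> :: real and n :: nat and A \<kappa> w :: "nat \<Rightarrow> real"
    and g :: "real \<Rightarrow> real \<Rightarrow> real" and ghat :: "real \<Rightarrow> real \<Rightarrow> complex"
  assumes W: "white_noise_integral M I"
    and \<alpha>: "\<alpha> \<ge> 0" and \<mu>: "\<mu> > 0" and \<beta>: "0 < \<beta>" "\<beta> \<le> 1"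
    and A: "\<forall>j\<le>n. A j \<ge> 0" "(\<Sum>j\<le>n. A j) = 1"
    and \<kappa>: "\<forall>j\<le>n. 0 < \<kappa> j \<and> \<kappa> j < 1"
    and w: "\<forall>j\<in>{1..n}. w j > 0"
    and gL2: "\<forall>x. (\<lambda>z. g z x) \<in> borel_measurable lborel \<and>
                   (\<integral>\<^sup>+ z. ennreal ((g z x)\<^sup>2) \<partial>lborel) < \<infinity>"
    and ghat: "\<forall>x. fourier_L2 (\<lambda>z. g z x) (\<lambda>l. ghat l x)"
  shows
   "((\<forall>x. sobolev_sq (- \<alpha>) (\<lambda>l. ghat l x) < \<infinity>) \<longrightarrow>
     (\<forall>\<theta> C. 0 < \<theta> \<and> \<theta> \<le> 1 \<and> C > 0 \<and>
        (\<forall>x y. sobolev_sq (- \<alpha>) (\<lambda>l. ghat l x - ghat l y) \<le> ennreal ((C * \<bar>x - y\<bar> powr \<theta>)\<^sup>2)) \<longrightarrow>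
        (\<forall>t>0. \<forall>\<gamma>. 0 < \<gamma> \<and> \<gamma> < \<theta> \<longrightarrow>
           ms_holder M \<gamma> (mlf_field I (C_kwA n \<kappa> w A) (\<lambda>l. 1) ghat \<beta> \<mu> \<alpha> t) \<and>
           holder_modification M \<gamma> (mlf_field I (C_kwA n \<kappa> w A) (\<lambda>l. 1) ghat \<beta> \<mu> \<alpha> t))))
    \<and>
    ((\<forall>t>0. \<forall>x. sq_int (\<lambda>l. ghat l x * complex_of_real
         (mittag_leffler \<beta> (- \<mu> * t powr \<beta> * \<bar>l\<bar> powr \<alpha>) * \<bar>l\<bar> powr ((\<kappa> 0 - 1) / 2)))) \<longrightarrow>
     (\<forall>\<theta>s C. 0 < \<theta>s \<and> C > 0 \<and>
        (\<forall>x y. sobolev_sq (- \<alpha>) (\<lambda>l. complex_of_real (\<bar>l\<bar> powr ((\<kappa> 0 - 1) / 2)) * (ghat l x - ghat l y))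
                 \<le> ennreal ((C * \<bar>x - y\<bar> powr \<theta>s)\<^sup>2)) \<longrightarrow>
        (\<forall>t>0. \<forall>\<gamma>. 0 < \<gamma> \<and> \<gamma> < \<theta>s \<longrightarrow>
           ms_holder M \<gamma> (mlf_field I (C_kA (\<kappa> 0) (A 0)) (\<lambda>l. \<bar>l\<bar> powr ((\<kappa> 0 - 1) / 2)) ghat \<beta> \<mu> \<alpha> t) \<and>
           holder_modification M \<gamma>
             (mlf_field I (C_kA (\<kappa> 0) (A 0)) (\<lambda>l. \<bar>l\<bar> powr ((\<kappa> 0 - 1) / 2)) ghat \<beta> \<mu> \<alpha> t))))"
proof (intro conjI impI allI)
  fix \<theta> C t \<gamma> :: real
  assume fin: "\<forall>x. sobolev_sq (- \<alpha>) (\<lambda>l. ghat l x) < \<infinity>"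
    and incr: "0 < \<theta> \<and> \<theta> \<le> 1 \<and> C > 0 \<and> (\<forall>x y. sobolev_sq (- \<alpha>) (\<lambda>l. ghat l x - ghat l y)
      \<le> ennreal ((C * \<bar>x - y\<bar> powr \<theta>)\<^sup>2))"
    and t: "0 < t" and \<gamma>: "0 < \<gamma> \<and> \<gamma> < \<theta>"
  have [measurable]: "(\<lambda>l. ghat l x) \<in> borel_measurable borel" for x
    using ghat by (simp add: fourier_L2_def)
  obtain D where D: "D \<ge> 0"
    "\<And>l. (mittag_leffler \<beta> (- \<mu> * t powr \<beta> * \<bar>l\<bar> powr \<alpha>))\<^sup>2 \<le> D * (1 + l\<^sup>2) powr (-\<alpha>)"
    using mittag_leffler_sobolev_multiplier[OF \<alpha> _ \<beta>, of "\<mu> * t powr \<beta>"] \<mu> t by auto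
  \<comment> \<open>For the first field square integrability follows from the finite Sobolev norm of
    order -\<alpha>; the factor 1 is kept to match m = 1 in the general field.\<close>
  have "sq_int (\<lambda>l. ghat l x * complex_of_real (mittag_leffler \<beta> (- \<mu> * t powr \<beta> * \<bar>l\<bar> powr \<alpha>) * 1))" for x
  proof -
    have "ennreal D * sobolev_sq (-\<alpha>) (\<lambda>l. complex_of_real 1 * ghat l x) < \<infinity>"
      using fin by (simp add: ennreal_mult_less_top)
    moreover have "(\<integral>\<^sup>+ l. ennreal ((cmod (ghat l x * complex_of_real
          (mittag_leffler \<beta> (- \<mu> * t powr \<beta> * \<bar>l\<bar> powr \<alpha>) * 1)))\<^sup>2) \<partial>lborel) \<le>
        ennreal D * sobolev_sq (-\<alpha>) (\<lambda>l. complex_of_real 1 * ghat l x)"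
      by (intro mittag_leffler_multiplier_nn_integral_le D) measurable
    ultimately show ?thesis unfolding sq_int_def by (auto intro: le_less_trans)
  qed
  then have "ms_holder M \<gamma> (mlf_field I (C_kwA n \<kappa> w A) (\<lambda>l. 1) ghat \<beta> \<mu> \<alpha> t) \<and>
      holder_modification M \<gamma> (mlf_field I (C_kwA n \<kappa> w A) (\<lambda>l. 1) ghat \<beta> \<mu> \<alpha> t)"
    using incr t \<gamma> gL2 ghat
    by (intro mlf_field_holder[OF W \<alpha> \<mu> \<beta>, where g = g and C = C and \<theta> = \<theta>]) auto
  then show "ms_holder M \<gamma> (mlf_field I (C_kwA n \<kappa> w A) (\<lambda>l. 1) ghat \<beta> \<mu> \<alpha> t)"
    and "holder_modification M \<gamma> (mlf_field I (C_kwA n \<kappa> w A) (\<lambda>l. 1) ghat \<beta> \<mu> \<alpha> t)"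
    by auto
next
  let ?m = "\<lambda>l::real. \<bar>l\<bar> powr ((\<kappa> 0 - 1) / 2)"
  fix \<theta> C t \<gamma> :: real
  assume sq: "\<forall>t>0. \<forall>x. sq_int (\<lambda>l. ghat l x * complex_of_real
      (mittag_leffler \<beta> (- \<mu> * t powr \<beta> * \<bar>l\<bar> powr \<alpha>) * ?m l))"
    and incr: "0 < \<theta> \<and> C > 0 \<and> (\<forall>x y. sobolev_sq (- \<alpha>) (\<lambda>l. complex_of_real (?m l) * (ghat l x - ghat l y))
      \<le> ennreal ((C * \<bar>x - y\<bar> powr \<theta>)\<^sup>2))"
    and t: "0 < t" and \<gamma>: "0 < \<gamma> \<and> \<gamma> < \<theta>"
  \<comment> \<open>Square integrability is taken from \<open>sq\<close> here, as the increment
    bound controls only differences of the transforms.\<close>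
  have "ms_holder M \<gamma> (mlf_field I (C_kA (\<kappa> 0) (A 0)) ?m ghat \<beta> \<mu> \<alpha> t) \<and>
      holder_modification M \<gamma> (mlf_field I (C_kA (\<kappa> 0) (A 0)) ?m ghat \<beta> \<mu> \<alpha> t)"
    using sq incr t \<gamma> gL2 ghat
    by (intro mlf_field_holder[OF W \<alpha> \<mu> \<beta>, where g = g and C = C and \<theta> = \<theta>]) auto
  then show "ms_holder M \<gamma> (mlf_field I (C_kA (\<kappa> 0) (A 0)) ?m ghat \<beta> \<mu> \<alpha> t)"
    and "holder_modification M \<gamma> (mlf_field I (C_kA (\<kappa> 0) (A 0)) ?m ghat \<beta> \<mu> \<alpha> t)"
    by auto
qed

end
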